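(* The sub-operad $\mathrm{Seg}$ of $\mathrm{G}$ generated by the segment graph on two vertices (the graph on $\{a,b\}$ with the single edge $\{a,b\}$) is isomorphic to $\mathrm{ComMag}$.
   Context: $\mathbb{K}$ is a field of characteristic $0$. A (linear) species is a functor from finite sets with bijections to $\mathbb{K}$-vector spaces. An operad is a species $O$ with $O[\emptyset]=\{0\}$, units $e(v)\in O[\{v\}]$, and natural bilinear partial compositions $\circ_*:O[V_1\sqcup\{*\}]\times O[V_2]\to O[V_1\sqcup V_2]$ satisfying the usual parallel and sequential associativity axioms and unit axioms of symmetric operads. The sub-operad generated by a set $E$ of elements is the smallest sub-species containing $E$ (hence stable under relabelling by bijections) and the units and stable under partial composition. Operad $\mathrm{G}$: $\mathrm{G}[V]$ ($V$ nonempty) has basis the simple graphs with vertex set $V$. For graphs $g_1$ on $V_1\sqcup\{*\}$ and $g_2$ on $V_2$, with $n( * )$ the set of neighbours of $*$ in $g_1$, $$g_1\circ_*g_2=\sum_{f:n( * )\to V_2}\Big(g_1|_{V_1}\cup\{\{v,f(v)\}:v\in n( * )\}\cup g_2\Big).$$ Units: one-vertex graphs. $\mathrm{ComMag}$ (commutative magmatic operad) is the free operad on one symmetric generator of arity $2$: $\mathrm{ComMag}[V]$ has basis the abstract (non-planar) rooted binary trees with set of leaves $V$, and partial composition is grafting of trees at leaves. *)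

theory Defs
  imports Complex_Main "HOL-Library.Poly_Mapping" "HOL-Library.FuncSet" "HOL-Library.Uprod"
begin

section \<open>Linear species and operads\<close>

text \<open>
  The finite sets are the finite subsets of a type \<open>'v\<close> (infinite wherever it matters, so that every
  finite set has a copy in \<open>'v\<close>). The vector spaces \<open>P[V]\<close> are subspaces \<open>spc P V\<close> of one ambient
  \<open>'k\<close>-vector space, the type \<open>'m\<close> with scalar multiplication \<open>smul P\<close>. The functor maps a
  bijection with domain \<open>V\<close>, given by some \<open>\<sigma>\<close> injective on \<open>V\<close>, to
  \<open>transport P V \<sigma> : P[V] \<rightarrow> P[\<sigma> ` V]\<close>. Only finite \<open>V\<close> are meaningful.
\<close>

record ('v, 'k, 'm) species =
  smul :: "'k \<Rightarrow> 'm \<Rightarrow> 'm"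
  spc :: "'v set \<Rightarrow> 'm set"
  transport :: "'v set \<Rightarrow> ('v \<Rightarrow> 'v) \<Rightarrow> 'm \<Rightarrow> 'm"

text \<open>
  \<open>pcomp P V\<^sub>1 a V\<^sub>2\<close> is the partial composition
  \<open>\<circ>\<^sub>a : P[V\<^sub>1 \<squnion> {a}] \<times> P[V\<^sub>2] \<rightarrow> P[V\<^sub>1 \<squnion> V\<^sub>2]\<close>. It is meaningful when both unions are disjoint,
  i.e. under \<open>composable V\<^sub>1 a V\<^sub>2\<close>; note that \<open>a \<in> V\<^sub>2\<close> is allowed.
\<close>

record ('v, 'k, 'm) operad = "('v, 'k, 'm) species" +
  ounit :: "'v \<Rightarrow> 'm"
  pcomp :: "'v set \<Rightarrow> 'v \<Rightarrow> 'v set \<Rightarrow> 'm \<Rightarrow> 'm \<Rightarrow> 'm"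

definition composable :: "'v set \<Rightarrow> 'v \<Rightarrow> 'v set \<Rightarrow> bool" where
  "composable V1 a V2 \<longleftrightarrow> finite V1 \<and> finite V2 \<and> a \<notin> V1 \<and> V1 \<inter> V2 = {}"

definition linear_on ::
    "'m set \<Rightarrow> ('k \<Rightarrow> 'm \<Rightarrow> 'm) \<Rightarrow> ('k \<Rightarrow> 'n \<Rightarrow> 'n) \<Rightarrow> ('m::plus \<Rightarrow> 'n::plus) \<Rightarrow> bool" where
  "linear_on S s t f \<longleftrightarrow>
     (\<forall>x\<in>S. \<forall>y\<in>S. f (x + y) = f x + f y) \<and> (\<forall>c. \<forall>x\<in>S. f (s c x) = t c (f x))"

locale linear_species =
  fixes P :: "('v, 'k::field, 'm::ab_group_add, 'z) species_scheme"
  assumes vector_space: "vector_space (smul P)"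
    and subspace: "finite V \<Longrightarrow> module.subspace (smul P) (spc P V)"
    and transport_mem:
      "\<lbrakk>finite V; inj_on \<sigma> V; x \<in> spc P V\<rbrakk> \<Longrightarrow> transport P V \<sigma> x \<in> spc P (\<sigma> ` V)"
    and transport_linear:
      "\<lbrakk>finite V; inj_on \<sigma> V\<rbrakk> \<Longrightarrow> linear_on (spc P V) (smul P) (smul P) (transport P V \<sigma>)"
    and transport_cong:
      "\<lbrakk>finite V; inj_on \<sigma> V; \<And>v. v \<in> V \<Longrightarrow> \<sigma> v = \<tau> v; x \<in> spc P V\<rbrakk>
        \<Longrightarrow> transport P V \<sigma> x = transport P V \<tau> x"
    and transport_id: "\<lbrakk>finite V; x \<in> spc P V\<rbrakk> \<Longrightarrow> transport P V id x = x"
    and transport_comp: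
      "\<lbrakk>finite V; inj_on \<sigma> V; inj_on \<tau> (\<sigma> ` V); x \<in> spc P V\<rbrakk>
        \<Longrightarrow> transport P (\<sigma> ` V) \<tau> (transport P V \<sigma> x) = transport P V (\<tau> \<circ> \<sigma>) x"

locale operad = linear_species P
  for P :: "('v, 'k::field, 'm::ab_group_add) operad" +
  assumes spc_empty: "spc P {} = {0}"
    and unit_mem: "ounit P v \<in> spc P {v}"
    and unit_natural: "transport P {v} \<sigma> (ounit P v) = ounit P (\<sigma> v)"
    and comp_mem:
      "\<lbrakk>composable V1 a V2; x \<in> spc P (insert a V1); y \<in> spc P V2\<rbrakk>
        \<Longrightarrow> pcomp P V1 a V2 x y \<in> spc P (V1 \<union> V2)"
    and comp_linear_left:
      "\<lbrakk>composable V1 a V2; y \<in> spc P V2\<rbrakk>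
        \<Longrightarrow> linear_on (spc P (insert a V1)) (smul P) (smul P) (\<lambda>x. pcomp P V1 a V2 x y)"
    and comp_linear_right:
      "\<lbrakk>composable V1 a V2; x \<in> spc P (insert a V1)\<rbrakk>
        \<Longrightarrow> linear_on (spc P V2) (smul P) (smul P) (\<lambda>y. pcomp P V1 a V2 x y)"
    and comp_natural:
      "\<lbrakk>composable V1 a V2; x \<in> spc P (insert a V1); y \<in> spc P V2;
        inj_on \<sigma> (insert a V1); inj_on \<tau> V2; inj_on \<rho> (V1 \<union> V2);
        \<And>v. v \<in> V1 \<Longrightarrow> \<rho> v = \<sigma> v; \<And>v. v \<in> V2 \<Longrightarrow> \<rho> v = \<tau> v\<rbrakk>
        \<Longrightarrow> transport P (V1 \<union> V2) \<rho> (pcomp P V1 a V2 x y)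
          = pcomp P (\<sigma> ` V1) (\<sigma> a) (\<tau> ` V2) (transport P (insert a V1) \<sigma> x) (transport P V2 \<tau> y)"
    and comp_sequential:
      "\<lbrakk>finite V1; finite V2; finite V3; V1 \<inter> V2 = {}; V1 \<inter> V3 = {}; V2 \<inter> V3 = {};
        a \<notin> V1; b \<notin> V1; b \<notin> V2;
        x \<in> spc P (insert a V1); y \<in> spc P (insert b V2); z \<in> spc P V3\<rbrakk>
        \<Longrightarrow> pcomp P (V1 \<union> V2) b V3 (pcomp P V1 a (insert b V2) x y) z
          = pcomp P V1 a (V2 \<union> V3) x (pcomp P V2 b V3 y z)"
    and comp_parallel:
      "\<lbrakk>finite V1; finite V2; finite V3; V1 \<inter> V2 = {}; V1 \<inter> V3 = {}; V2 \<inter> V3 = {};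
        a \<noteq> b; a \<notin> V1; b \<notin> V1; b \<notin> V2; a \<notin> V3;
        x \<in> spc P (insert a (insert b V1)); y \<in> spc P V2; z \<in> spc P V3\<rbrakk>
        \<Longrightarrow> pcomp P (V1 \<union> V2) b V3 (pcomp P (insert b V1) a V2 x y) z
          = pcomp P (V1 \<union> V3) a V2 (pcomp P (insert a V1) b V3 x z) y"
    and comp_unit_right:
      "\<lbrakk>finite V; a \<notin> V; v \<notin> V; x \<in> spc P (insert a V)\<rbrakk>
        \<Longrightarrow> pcomp P V a {v} x (ounit P v) = transport P (insert a V) (id(a := v)) x"
    and comp_unit_left:
      "\<lbrakk>finite V; x \<in> spc P V\<rbrakk> \<Longrightarrow> pcomp P {} a V (ounit P a) x = x"

definition operad_hom ::
    "('v, 'k::field, 'm::ab_group_add) operad \<Rightarrow> ('v, 'k, 'n::ab_group_add) operad \<Rightarrow>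
      ('v set \<Rightarrow> 'm \<Rightarrow> 'n) \<Rightarrow> bool" where
  "operad_hom P Q \<phi> \<longleftrightarrow>
     (\<forall>V. finite V \<longrightarrow> \<phi> V ` spc P V \<subseteq> spc Q V \<and> linear_on (spc P V) (smul P) (smul Q) (\<phi> V)) \<and>
     (\<forall>V \<sigma>. \<forall>x\<in>spc P V. finite V \<longrightarrow> inj_on \<sigma> V \<longrightarrow>
        \<phi> (\<sigma> ` V) (transport P V \<sigma> x) = transport Q V \<sigma> (\<phi> V x)) \<and>
     (\<forall>v. \<phi> {v} (ounit P v) = ounit Q v) \<and>
     (\<forall>V1 a V2. \<forall>x\<in>spc P (insert a V1). \<forall>y\<in>spc P V2. composable V1 a V2 \<longrightarrow>
        \<phi> (V1 \<union> V2) (pcomp P V1 a V2 x y) = pcomp Q V1 a V2 (\<phi> (insert a V1) x) (\<phi> V2 y))"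

definition operad_isomorphic ::
    "('v, 'k::field, 'm::ab_group_add) operad \<Rightarrow> ('v, 'k, 'n::ab_group_add) operad \<Rightarrow> bool" where
  "operad_isomorphic P Q \<longleftrightarrow> operad P \<and> operad Q \<and>
     (\<exists>\<phi>. operad_hom P Q \<phi> \<and> (\<forall>V. finite V \<longrightarrow> bij_betw (\<phi> V) (spc P V) (spc Q V)))"

definition suboperad ::
    "('v, 'k::field, 'm::ab_group_add) operad \<Rightarrow> ('v set \<Rightarrow> 'm set) \<Rightarrow> bool" where
  "suboperad P S \<longleftrightarrow>
     (\<forall>V. finite V \<longrightarrow> S V \<subseteq> spc P V \<and> module.subspace (smul P) (S V)) \<and>
     (\<forall>V \<sigma>. \<forall>x\<in>S V. finite V \<longrightarrow> inj_on \<sigma> V \<longrightarrow> transport P V \<sigma> x \<in> S (\<sigma> ` V)) \<and>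
     (\<forall>v. ounit P v \<in> S {v}) \<and>
     (\<forall>V1 a V2. \<forall>x\<in>S (insert a V1). \<forall>y\<in>S V2. composable V1 a V2 \<longrightarrow>
        pcomp P V1 a V2 x y \<in> S (V1 \<union> V2))"

text \<open>An element \<open>x \<in> P[V]\<close> is given as the pair \<open>(V, x)\<close>.\<close>

definition generated_suboperad ::
    "('v, 'k::field, 'm::ab_group_add) operad \<Rightarrow> ('v set \<times> 'm) set \<Rightarrow> ('v, 'k, 'm) operad" where
  "generated_suboperad P E =
     P\<lparr>spc := (\<lambda>V. \<Inter>{S V | S. suboperad P S \<and> (\<forall>(W, x)\<in>E. x \<in> S W)})\<rparr>"


section \<open>Operads with a basis\<close>

text \<open>
  The free vector space on a set \<open>B\<close> consists of the finitely supported functions \<open>'b \<Rightarrow>\<^sub>0 'k\<close>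
  with support in \<open>B\<close>; the basis vector of \<open>g\<close> is \<open>Poly_Mapping.single g 1\<close>.
\<close>

definition pm_scale :: "'k::field \<Rightarrow> ('b \<Rightarrow>\<^sub>0 'k) \<Rightarrow> ('b \<Rightarrow>\<^sub>0 'k)" where
  "pm_scale c = Poly_Mapping.map ((*) c)"

definition free_space :: "'b set \<Rightarrow> ('b \<Rightarrow>\<^sub>0 'k::field) set" where
  "free_space B = {p. Poly_Mapping.keys p \<subseteq> B}"

definition lin_ext :: "('b \<Rightarrow> ('c \<Rightarrow>\<^sub>0 'k::field)) \<Rightarrow> ('b \<Rightarrow>\<^sub>0 'k) \<Rightarrow> ('c \<Rightarrow>\<^sub>0 'k)" where
  "lin_ext f p = (\<Sum>g\<in>Poly_Mapping.keys p. pm_scale (Poly_Mapping.lookup p g) (f g))"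

text \<open>
  The structure with \<open>P[V]\<close> free on \<open>B V\<close>, relabelling \<open>r\<close> and units \<open>u\<close> given on basis elements,
  and the bilinear extension of a composition \<open>c\<close> of basis elements.
\<close>

definition basis_operad ::
    "('v set \<Rightarrow> 'b set) \<Rightarrow> (('v \<Rightarrow> 'v) \<Rightarrow> 'b \<Rightarrow> 'b) \<Rightarrow> ('v \<Rightarrow> 'b) \<Rightarrow>
      ('v set \<Rightarrow> 'v \<Rightarrow> 'v set \<Rightarrow> 'b \<Rightarrow> 'b \<Rightarrow> ('b \<Rightarrow>\<^sub>0 'k)) \<Rightarrow> ('v, 'k::field, 'b \<Rightarrow>\<^sub>0 'k) operad" where
  "basis_operad B r u c =
     \<lparr>smul = pm_scale,
      spc = (\<lambda>V. free_space (B V)),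
      transport = (\<lambda>V \<sigma>. lin_ext (\<lambda>g. Poly_Mapping.single (r \<sigma> g) 1)),
      ounit = (\<lambda>v. Poly_Mapping.single (u v) 1),
      pcomp = (\<lambda>V1 a V2 x y. lin_ext (\<lambda>g. lin_ext (\<lambda>h. c V1 a V2 g h) y) x)\<rparr>"


section \<open>The operad of simple graphs\<close>

text \<open>A simple graph is the pair of its vertex set and its set of edges, which are 2-element sets.\<close>

type_synonym 'v sgraph = "'v set \<times> 'v set set"

definition simple_graphs :: "'v set \<Rightarrow> 'v sgraph set" where
  "simple_graphs V =
     (if V = {} then {} else {(V, E) | E. E \<subseteq> {{u, v} | u v. u \<in> V \<and> v \<in> V \<and> u \<noteq> v}})"

definition neighbours :: "'v sgraph \<Rightarrow> 'v \<Rightarrow> 'v set" where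
  "neighbours g a = {v. {v, a} \<in> snd g}"

definition induced_subgraph :: "'v sgraph \<Rightarrow> 'v set \<Rightarrow> 'v sgraph" where
  "induced_subgraph g W = (W, {e \<in> snd g. e \<subseteq> W})"

definition graph_insert :: "'v set \<Rightarrow> 'v \<Rightarrow> 'v sgraph \<Rightarrow> 'v sgraph \<Rightarrow> ('v \<Rightarrow> 'v) \<Rightarrow> 'v sgraph" where
  "graph_insert V1 a g1 g2 f =
     (V1 \<union> fst g2,
      snd (induced_subgraph g1 V1) \<union> {{v, f v} | v. v \<in> neighbours g1 a} \<union> snd g2)"

definition graph_comp ::
    "'v set \<Rightarrow> 'v \<Rightarrow> 'v set \<Rightarrow> 'v sgraph \<Rightarrow> 'v sgraph \<Rightarrow> ('v sgraph \<Rightarrow>\<^sub>0 'k::field)" where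
  "graph_comp V1 a V2 g1 g2 =
     (\<Sum>f \<in> neighbours g1 a \<rightarrow>\<^sub>E V2. Poly_Mapping.single (graph_insert V1 a g1 g2 f) 1)"

definition Graph_operad :: "('v, 'k::field, 'v sgraph \<Rightarrow>\<^sub>0 'k) operad" where
  "Graph_operad =
     basis_operad simple_graphs (\<lambda>\<sigma> (V, E). (\<sigma> ` V, image \<sigma> ` E)) (\<lambda>v. ({v}, {})) graph_comp"

definition segment :: "'v \<Rightarrow> 'v \<Rightarrow> ('v sgraph \<Rightarrow>\<^sub>0 'k::field)" where
  "segment a b = Poly_Mapping.single ({a, b}, {{a, b}}) 1"

definition Seg :: "'v \<Rightarrow> 'v \<Rightarrow> ('v, 'k::field, 'v sgraph \<Rightarrow>\<^sub>0 'k) operad" where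
  "Seg a b = generated_suboperad Graph_operad {({a, b}, segment a b)}"


section \<open>The commutative magmatic operad\<close>

text \<open>
  The two subtrees at an inner node form an unordered pair, so the trees are non-planar.
  \<open>is_tree_on V t\<close> states that the leaf labels of \<open>t\<close> are pairwise distinct and form the set \<open>V\<close>.
\<close>

datatype 'v ctree = Leaf 'v | Node "'v ctree uprod"

inductive is_tree_on :: "'v set \<Rightarrow> 'v ctree \<Rightarrow> bool" where
  Leaf: "is_tree_on {v} (Leaf v)"
| Node: "\<lbrakk>is_tree_on V s; is_tree_on W t; V \<inter> W = {}\<rbrakk> \<Longrightarrow> is_tree_on (V \<union> W) (Node (Upair s t))"

primrec graft :: "'v \<Rightarrow> 'v ctree \<Rightarrow> 'v ctree \<Rightarrow> 'v ctree" where
  "graft a t (Leaf v) = (if v = a then t else Leaf v)"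
| "graft a t (Node p) = Node (map_uprod (graft a t) p)"

definition ComMag :: "('v, 'k::field, 'v ctree \<Rightarrow>\<^sub>0 'k) operad" where
  "ComMag =
     basis_operad (\<lambda>V. {t. is_tree_on V t}) map_ctree Leaf
       (\<lambda>V1 a V2 s t. Poly_Mapping.single (graft a t s) 1)"


section \<open>Both structures are operads\<close>

lemma lookup_pm_scale [simp]: "Poly_Mapping.lookup (pm_scale c p) k = c * Poly_Mapping.lookup p k"
  unfolding pm_scale_def by (simp add: Poly_Mapping.map.rep_eq when_def)

lemma vector_space_pm_scale: "vector_space pm_scale"
  by unfold_locales (auto intro!: poly_mapping_eqI simp: lookup_add algebra_simps)

lemma pm_scale_add: "pm_scale c (p + q) = pm_scale c p + pm_scale c q"
  by (rule poly_mapping_eqI) (simp add: lookup_add algebra_simps)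

lemma free_space_iff: "p \<in> free_space B \<longleftrightarrow> (\<forall>k. k \<notin> B \<longrightarrow> Poly_Mapping.lookup p k = 0)"
  by (auto simp: free_space_def in_keys_iff)

lemma subspace_free_space: "module.subspace pm_scale (free_space B)"
proof -
  interpret vector_space pm_scale by (rule vector_space_pm_scale)
  show ?thesis unfolding subspace_def by (auto simp: free_space_iff lookup_add)
qed

lemma lookup_lin_ext: 
  "Poly_Mapping.lookup (lin_ext f p) k = (\<Sum>g\<in>Poly_Mapping.keys p. Poly_Mapping.lookup p g * Poly_Mapping.lookup (f g) k)"
  by (simp add: lin_ext_def lookup_sum)

lemma lookup_lin_ext_superset:
  assumes "finite A" "Poly_Mapping.keys p \<subseteq> A"
  shows "Poly_Mapping.lookup (lin_ext f p) k = (\<Sum>g\<in>A. Poly_Mapping.lookup p g * Poly_Mapping.lookup (f g) k)"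
  unfolding lookup_lin_ext
  by (rule sum.mono_neutral_left) (use assms in \<open>auto simp: in_keys_iff\<close>)

lemma lin_ext_single [simp]: "lin_ext f (Poly_Mapping.single g 1) = f g"
  by (rule poly_mapping_eqI) (simp add: lookup_lin_ext)

lemma lin_ext_add: "lin_ext f (p + q) = lin_ext f p + lin_ext f q"
proof (rule poly_mapping_eqI)
  fix k
  let ?A = "Poly_Mapping.keys p \<union> Poly_Mapping.keys q"
  have "Poly_Mapping.keys (p+q) \<subseteq> ?A" by (rule keys_add)
  then show "Poly_Mapping.lookup (lin_ext f (p + q)) k = Poly_Mapping.lookup (lin_ext f p + lin_ext f q) k"
    by (simp add: lookup_add lookup_lin_ext_superset[where A = ?A] sum.distrib algebra_simps)
qed

lemma lin_ext_scale: "lin_ext f (pm_scale c p) = pm_scale c (lin_ext f p)"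
proof (rule poly_mapping_eqI)
  fix k
  have "Poly_Mapping.keys (pm_scale c p) \<subseteq> Poly_Mapping.keys p" by (auto simp: in_keys_iff)
  then show "Poly_Mapping.lookup (lin_ext f (pm_scale c p)) k = Poly_Mapping.lookup (pm_scale c (lin_ext f p)) k"
    by (simp add: lookup_lin_ext_superset[where A = "Poly_Mapping.keys p"] sum_distrib_left algebra_simps)
qed

lemma lin_ext_zero [simp]: "lin_ext f 0 = 0" by (simp add: lin_ext_def)

lemma lin_ext_sum: "lin_ext f (\<Sum>i\<in>I. p i) = (\<Sum>i\<in>I. lin_ext f (p i))"
  by (induction I rule: infinite_finite_induct) (simp_all add: lin_ext_add)

lemma lin_ext_cong: "(\<And>g. g \<in> Poly_Mapping.keys p \<Longrightarrow> f g = f' g) \<Longrightarrow> lin_ext f p = lin_ext f' p"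
  by (simp add: lin_ext_def)

lemma lin_ext_cong': "p \<in> free_space B \<Longrightarrow> (\<And>g. g \<in> B \<Longrightarrow> f g = f' g) \<Longrightarrow> lin_ext f p = lin_ext f' p"
  by (rule lin_ext_cong) (auto simp: free_space_def)

lemma lin_ext_id: "lin_ext (\<lambda>g. Poly_Mapping.single g 1) p = p"
  by (rule poly_mapping_eqI)
     (auto simp: lookup_lin_ext lookup_single when_def in_keys_iff if_distrib[of "(*) _"] cong: if_cong)

lemma lin_ext_lin_ext: "lin_ext f (lin_ext g p) = lin_ext (\<lambda>x. lin_ext f (g x)) p"
  by (simp add: lin_ext_def[of g] lin_ext_def[of "\<lambda>x. lin_ext f (g x)"] lin_ext_sum lin_ext_scale)

lemma lin_ext_fun_add: "lin_ext (\<lambda>g. f g + f' g) p = lin_ext f p + lin_ext f' p"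
  by (rule poly_mapping_eqI) (simp add: lookup_lin_ext lookup_add sum.distrib algebra_simps)

lemma lin_ext_fun_scale: "lin_ext (\<lambda>g. pm_scale c (f g)) p = pm_scale c (lin_ext f p)"
  by (rule poly_mapping_eqI) (simp add: lookup_lin_ext sum_distrib_left algebra_simps)

lemma lin_ext_swap: "lin_ext (\<lambda>g. lin_ext (f g) q) p = lin_ext (\<lambda>h. lin_ext (\<lambda>g. f g h) p) q"
proof (rule poly_mapping_eqI, goal_cases)
  case (1 k)
  show ?case
    unfolding lookup_lin_ext sum_distrib_left
    by (subst sum.swap) (simp add: mult_ac)
qed

lemma lin_ext_mem: "p \<in> free_space B \<Longrightarrow> (\<And>g. g \<in> B \<Longrightarrow> f g \<in> free_space C) \<Longrightarrow> lin_ext f p \<in> free_space C"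
  unfolding free_space_iff lookup_lin_ext by (force intro!: sum.neutral simp: in_keys_iff)

lemma single_mem [simp]: "Poly_Mapping.single g 1 \<in> (free_space B :: ('b \<Rightarrow>\<^sub>0 'k::field) set) \<longleftrightarrow> g \<in> B"
  by (auto simp: free_space_def)

lemma sum_mem: "(\<And>i. i \<in> I \<Longrightarrow> p i \<in> free_space B) \<Longrightarrow> (\<Sum>i\<in>I. p i) \<in> free_space B"
  unfolding free_space_iff by (auto simp: lookup_sum intro!: sum.neutral)

lemma linear_on_lin_ext: "linear_on S pm_scale pm_scale (lin_ext f)"
  by (simp add: linear_on_def lin_ext_add lin_ext_scale)

lemma basis_operadI:
  fixes c :: "'v set \<Rightarrow> 'v \<Rightarrow> 'v set \<Rightarrow> 'b \<Rightarrow> 'b \<Rightarrow> ('b \<Rightarrow>\<^sub>0 'k::field)"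
  assumes r_mem: "\<And>V \<sigma> g. \<lbrakk>finite V; inj_on \<sigma> V; g \<in> B V\<rbrakk> \<Longrightarrow> r \<sigma> g \<in> B (\<sigma> ` V)"
    and r_cong: "\<And>V \<sigma> \<tau> g. \<lbrakk>finite V; inj_on \<sigma> V; \<And>v. v \<in> V \<Longrightarrow> \<sigma> v = \<tau> v; g \<in> B V\<rbrakk> \<Longrightarrow> r \<sigma> g = r \<tau> g"
    and r_id: "\<And>V g. finite V \<Longrightarrow> g \<in> B V \<Longrightarrow> r id g = g"
    and r_comp: "\<And>V \<sigma> \<tau> g. \<lbrakk>finite V; inj_on \<sigma> V; inj_on \<tau> (\<sigma> ` V); g \<in> B V\<rbrakk> \<Longrightarrow> r \<tau> (r \<sigma> g) = r (\<tau> \<circ> \<sigma>) g"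
    and B_empty: "B {} = {}"
    and u_mem: "\<And>v. u v \<in> B {v}"
    and r_u: "\<And>\<sigma> v. r \<sigma> (u v) = u (\<sigma> v)"
    and c_mem: "\<And>V1 a V2 g h. composable V1 a V2 \<Longrightarrow> g \<in> B (insert a V1) \<Longrightarrow> h \<in> B V2 \<Longrightarrow>
        c V1 a V2 g h \<in> free_space (B (V1 \<union> V2))"
    and c_nat: "\<And>V1 a V2 g h \<sigma> \<tau> \<rho>. \<lbrakk>composable V1 a V2; g \<in> B (insert a V1); h \<in> B V2;
        inj_on \<sigma> (insert a V1); inj_on \<tau> V2; inj_on \<rho> (V1 \<union> V2);
        \<And>v. v \<in> V1 \<Longrightarrow> \<rho> v = \<sigma> v; \<And>v. v \<in> V2 \<Longrightarrow> \<rho> v = \<tau> v\<rbrakk> \<Longrightarrow>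
        lin_ext (\<lambda>k. Poly_Mapping.single (r \<rho> k) 1) (c V1 a V2 g h) = c (\<sigma> ` V1) (\<sigma> a) (\<tau> ` V2) (r \<sigma> g) (r \<tau> h)"
    and c_seq: "\<And>V1 V2 V3 a b x y z. \<lbrakk>finite V1; finite V2; finite V3; V1 \<inter> V2 = {}; V1 \<inter> V3 = {}; V2 \<inter> V3 = {};
        a \<notin> V1; b \<notin> V1; b \<notin> V2;
        x \<in> B (insert a V1); y \<in> B (insert b V2); z \<in> B V3\<rbrakk> \<Longrightarrow>
        lin_ext (\<lambda>s. c (V1 \<union> V2) b V3 s z) (c V1 a (insert b V2) x y) = lin_ext (c V1 a (V2 \<union> V3) x) (c V2 b V3 y z)"
    and c_par: "\<And>V1 V2 V3 a b x y z. \<lbrakk>finite V1; finite V2; finite V3; V1 \<inter> V2 = {}; V1 \<inter> V3 = {}; V2 \<inter> V3 = {};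
        a \<noteq> b; a \<notin> V1; b \<notin> V1; b \<notin> V2; a \<notin> V3;
        x \<in> B (insert a (insert b V1)); y \<in> B V2; z \<in> B V3\<rbrakk> \<Longrightarrow>
        lin_ext (\<lambda>s. c (V1 \<union> V2) b V3 s z) (c (insert b V1) a V2 x y) =
        lin_ext (\<lambda>s. c (V1 \<union> V3) a V2 s y) (c (insert a V1) b V3 x z)"
    and c_unit_right: "\<And>V a v g. \<lbrakk>finite V; a \<notin> V; v \<notin> V; g \<in> B (insert a V)\<rbrakk> \<Longrightarrow>
        c V a {v} g (u v) = Poly_Mapping.single (r (id(a := v)) g) 1"
    and c_unit_left: "\<And>V a g. finite V \<Longrightarrow> g \<in> B V \<Longrightarrow> c {} a V (u a) g = Poly_Mapping.single g 1"
  shows "operad (basis_operad B r u c)"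
proof (rule operad.intro[OF linear_species.intro operad_axioms.intro], goal_cases)
  case 1 show ?case by (simp add: basis_operad_def vector_space_pm_scale)
next
  case 2 show ?case by (simp add: basis_operad_def subspace_free_space)
next
  case (3 V \<sigma> x) then show ?case by (auto simp: basis_operad_def r_mem intro!: lin_ext_mem)
next
  case 4 then show ?case by (simp add: basis_operad_def linear_on_lin_ext)
next
  case (5 V \<sigma> \<tau> x) then show ?case
    by (auto simp: basis_operad_def intro!: lin_ext_cong' r_cong arg_cong[where f = "\<lambda>x. Poly_Mapping.single x 1"])
next
  case (6 V x) 
  then have "lin_ext (\<lambda>g. Poly_Mapping.single (r id g) 1) x = lin_ext (\<lambda>g. Poly_Mapping.single g 1) x"
    by (auto simp: basis_operad_def r_id intro!: lin_ext_cong')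
  then show ?case by (simp add: basis_operad_def lin_ext_id)
next
  case (7 V \<sigma> \<tau> x) then show ?case
    by (auto simp: basis_operad_def lin_ext_lin_ext r_comp intro!: lin_ext_cong' )
next
  case 8 show ?case by (auto simp: basis_operad_def B_empty free_space_def)
next
  case 9 show ?case by (auto simp: basis_operad_def u_mem)
next
  case 10 show ?case by (auto simp: basis_operad_def r_u)
next
  case 11 then show ?case by (auto simp: basis_operad_def intro!: lin_ext_mem c_mem)
next
  case 12 then show ?case by (simp add: basis_operad_def linear_on_lin_ext)
next
  case 13 then show ?case
    by (simp add: basis_operad_def linear_on_def lin_ext_add lin_ext_scale lin_ext_fun_add lin_ext_fun_scale pm_scale_add)
next
  case (14 V1 a V2 x y \<sigma> \<tau> \<rho>)
  then show ?case
    by (auto simp: basis_operad_def lin_ext_lin_ext intro!: lin_ext_cong'[of x] lin_ext_cong'[of y] c_nat)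
next
  case (15 V1 V2 V3 a b x y z)
  have "lin_ext (\<lambda>g. lin_ext (c (V1 \<union> V2) b V3 g) z) (lin_ext (\<lambda>g. lin_ext (c V1 a (insert b V2) g) y) x)
     = lin_ext (\<lambda>u. lin_ext (\<lambda>v. lin_ext (\<lambda>w. lin_ext (\<lambda>s. c (V1 \<union> V2) b V3 s w) (c V1 a (insert b V2) u v)) z) y) x"
    unfolding lin_ext_lin_ext by (subst lin_ext_swap) simp
  also have "\<dots> = lin_ext (\<lambda>u. lin_ext (\<lambda>v. lin_ext (\<lambda>w. lin_ext (c V1 a (V2 \<union> V3) u) (c V2 b V3 v w)) z) y) x"
    using 15 by (auto simp: basis_operad_def intro!: lin_ext_cong'[of x] lin_ext_cong'[of y] lin_ext_cong'[of z] c_seq)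
  also have "\<dots> = lin_ext (\<lambda>g. lin_ext (c V1 a (V2 \<union> V3) g) (lin_ext (\<lambda>g. lin_ext (c V2 b V3 g) z) y)) x"
    unfolding lin_ext_lin_ext by simp
  finally show ?case by (simp add: basis_operad_def)
next
  case (16 V1 V2 V3 a b x y z)
  have "lin_ext (\<lambda>g. lin_ext (c (V1 \<union> V2) b V3 g) z) (lin_ext (\<lambda>g. lin_ext (c (insert b V1) a V2 g) y) x)
     = lin_ext (\<lambda>u. lin_ext (\<lambda>v. lin_ext (\<lambda>w. lin_ext (\<lambda>s. c (V1 \<union> V2) b V3 s w) (c (insert b V1) a V2 u v)) z) y) x"
    unfolding lin_ext_lin_ext by (subst lin_ext_swap) simp
  also have "\<dots> = lin_ext (\<lambda>u. lin_ext (\<lambda>v. lin_ext (\<lambda>w. lin_ext (\<lambda>s. c (V1 \<union> V3) a V2 s v) (c (insert a V1) b V3 u w)) z) y) x"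
    using 16 by (auto simp: basis_operad_def intro!: lin_ext_cong'[of x] lin_ext_cong'[of y] lin_ext_cong'[of z] c_par)
  also have "\<dots> = lin_ext (\<lambda>u. lin_ext (\<lambda>w. lin_ext (\<lambda>v. lin_ext (\<lambda>s. c (V1 \<union> V3) a V2 s v) (c (insert a V1) b V3 u w)) y) z) x"
    by (subst lin_ext_swap) simp
  also have "\<dots> = lin_ext (\<lambda>g. lin_ext (c (V1 \<union> V3) a V2 g) y) (lin_ext (\<lambda>g. lin_ext (c (insert a V1) b V3 g) z) x)"
    unfolding lin_ext_lin_ext by (subst (2) lin_ext_swap) simp
  finally show ?case by (simp add: basis_operad_def)
next
  case (17 V a v x)
  then show ?case by (auto simp: basis_operad_def intro!: lin_ext_cong' c_unit_right)
next
  case (18 V x a)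
  then have "lin_ext (\<lambda>g. c {} a V (u a) g) x = lin_ext (\<lambda>g. Poly_Mapping.single g 1) x"
    by (auto simp: basis_operad_def c_unit_left intro!: lin_ext_cong')
  then show ?case by (simp add: basis_operad_def lin_ext_id)
qed

lemma is_tree_on_set: "is_tree_on V t \<Longrightarrow> V = set_ctree t"
  by (induction rule: is_tree_on.induct) auto

lemma is_tree_on_nonempty: "is_tree_on V t \<Longrightarrow> V \<noteq> {} \<and> finite V"
  by (induction rule: is_tree_on.induct) auto

lemma is_tree_map: "is_tree_on V t \<Longrightarrow> inj_on \<sigma> V \<Longrightarrow> is_tree_on (\<sigma> ` V) (map_ctree \<sigma> t)"
proof (induction rule: is_tree_on.induct)
  case (Node V s W t)
  then have "\<sigma> ` V \<inter> \<sigma> ` W = {}" by (auto simp: inj_on_Un)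
  then show ?case using Node by (auto simp: image_Un inj_on_Un intro!: is_tree_on.Node)
qed (auto intro: is_tree_on.Leaf)

lemma graft_notin: "a \<notin> set_ctree t \<Longrightarrow> graft a s t = t"
proof (induction t)
  case (Node p)
  then show ?case by (cases p) auto
qed auto

lemma is_tree_graft: 
  assumes "is_tree_on W t" 
  shows "is_tree_on V s \<Longrightarrow> a \<in> V \<Longrightarrow> (V - {a}) \<inter> W = {} \<Longrightarrow> is_tree_on ((V - {a}) \<union> W) (graft a t s)"
proof (induction rule: is_tree_on.induct)
  case (Leaf v)
  then show ?case using assms by auto
next
  case (Node V1 s1 V2 s2)
  have s: "V1 = set_ctree s1" "V2 = set_ctree s2" using Node is_tree_on_set by auto
  show ?case
  proof (cases "a \<in> V1")
    case True
    then have a2: "a \<notin> V2" using Node by auto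
    then have "is_tree_on (((V1 - {a}) \<union> W) \<union> V2) (graft a t (Node (Upair s1 s2)))"
      using Node True s by (auto simp: graft_notin intro!: is_tree_on.Node)
    moreover have "((V1 - {a}) \<union> W) \<union> V2 = (V1 \<union> V2) - {a} \<union> W" using a2 by auto
    ultimately show ?thesis by simp
  next
    case False
    then have "is_tree_on (V1 \<union> ((V2 - {a}) \<union> W)) (graft a t (Node (Upair s1 s2)))"
      using Node s by (auto simp: graft_notin intro!: is_tree_on.Node)
    moreover have "V1 \<union> ((V2 - {a}) \<union> W) = (V1 \<union> V2) - {a} \<union> W" using False by auto
    ultimately show ?thesis by simp
  qed
qed

lemma graft_map:
  assumes "\<And>v. v \<in> set_ctree s \<Longrightarrow> v \<noteq> a \<Longrightarrow> \<rho> v = \<sigma> v" "\<And>v. v \<in> set_ctree t \<Longrightarrow> \<rho> v = \<tau> v"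
    "\<And>v. v \<in> set_ctree s \<Longrightarrow> \<sigma> v = \<sigma> a \<Longrightarrow> v = a"
  shows "map_ctree \<rho> (graft a t s) = graft (\<sigma> a) (map_ctree \<tau> t) (map_ctree \<sigma> s)"
  using assms
proof (induction s)
  case (Leaf x)
  then show ?case by (auto intro: ctree.map_cong)
next
  case (Node p)
  obtain s1 s2 where [simp]: "p = Upair s1 s2" by (cases p) 
  have "map_ctree \<rho> (graft a t s1) = graft (\<sigma> a) (map_ctree \<tau> t) (map_ctree \<sigma> s1)"
    by (rule Node.IH) (use Node.prems in auto)
  moreover have "map_ctree \<rho> (graft a t s2) = graft (\<sigma> a) (map_ctree \<tau> t) (map_ctree \<sigma> s2)"
    by (rule Node.IH) (use Node.prems in auto)
  ultimately show ?case by simp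
qed

lemma graft_seq: "b \<notin> set_ctree s - {a} \<Longrightarrow> graft b z (graft a y s) = graft a (graft b z y) s"
proof (induction s)
  case (Node p)
  then show ?case by (cases p) auto
qed auto

lemma graft_par: "a \<noteq> b \<Longrightarrow> b \<notin> set_ctree y \<Longrightarrow> a \<notin> set_ctree z \<Longrightarrow> graft b z (graft a y s) = graft a y (graft b z s)"
proof (induction s)
  case (Node p)
  then show ?case by (cases p) auto
qed (auto simp: graft_notin)

lemma graft_Leaf: "graft a (Leaf v) s = map_ctree (id(a := v)) s"
proof (induction s)
  case (Node p)
  then show ?case by (cases p) auto
qed auto

lemma neighboursD: "g \<in> simple_graphs W \<Longrightarrow> v \<in> neighbours g a \<Longrightarrow> v \<in> W \<and> a \<in> W \<and> v \<noteq> a"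
  by (fastforce simp: simple_graphs_def neighbours_def doubleton_eq_iff split: if_splits)

lemma operad_ComMag: "operad (ComMag :: ('v, 'k::field, _) operad)"
  unfolding ComMag_def
proof (rule basis_operadI, goal_cases)
  case (1 V \<sigma> g) then show ?case by (auto simp: is_tree_map)
next
  case (2 V \<sigma> \<tau> g) then show ?case using is_tree_on_set[of V g] by (auto intro!: ctree.map_cong)
next
  case 3 then show ?case by (auto simp: ctree.map_id)
next
  case 4 then show ?case by (auto simp: ctree.map_comp)
next
  case 5 then show ?case using is_tree_on_nonempty by auto
next
  case 6 then show ?case by (auto intro: is_tree_on.Leaf)
next
  case 7 then show ?case by auto
next
  case (8 V1 a V2 g h)
  then show ?case using is_tree_graft[of V2 h "insert a V1" g a] by (auto simp: composable_def)
next
  case (9 V1 a V2 g h \<sigma> \<tau> \<rho>)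
  then have e: "set_ctree g = insert a V1" "set_ctree h = V2" using is_tree_on_set by blast+
  have "map_ctree \<rho> (graft a h g) = graft (\<sigma> a) (map_ctree \<tau> h) (map_ctree \<sigma> g)"
    using 9(7,8) inj_onD[OF 9(4), of _ a] by (intro graft_map) (auto simp: e)
  then show ?case by simp
next
  case (10 V1 V2 V3 a b x y z)
  then have "set_ctree x = insert a V1" using is_tree_on_set by blast
  then show ?case using 10 by (simp add: graft_seq)
next
  case (11 V1 V2 V3 a b x y z)
  then have "set_ctree y = V2" "set_ctree z = V3" using is_tree_on_set by blast+
  then show ?case using 11 by (simp add: graft_par)
next
  case 12 then show ?case by (simp add: graft_Leaf)
next
  case 13 then show ?case by simp
qed


lemma edgeD: "g \<in> simple_graphs W \<Longrightarrow> e \<in> snd g \<Longrightarrow> \<exists>u v. e = {u,v} \<and> u \<in> W \<and> v \<in> W \<and> u \<noteq> v"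
  by (fastforce simp: simple_graphs_def split: if_splits)

lemma fst_simple: "g \<in> simple_graphs W \<Longrightarrow> fst g = W"
  by (auto simp: simple_graphs_def split: if_splits)

lemma simple_graphs_iff: 
  "g \<in> simple_graphs W \<longleftrightarrow> W \<noteq> {} \<and> fst g = W \<and> (\<forall>e\<in>snd g. \<exists>u v. e = {u,v} \<and> u \<in> W \<and> v \<in> W \<and> u \<noteq> v)"
  by (cases g) (auto simp: simple_graphs_def)

lemma graph_insert_alt:
  "graph_insert V1 a g1 g2 f = (V1 \<union> fst g2, {e \<in> snd g1. e \<subseteq> V1} \<union> (\<lambda>v. {v, f v}) ` neighbours g1 a \<union> snd g2)"
  by (auto simp: graph_insert_def induced_subgraph_def)

lemma graph_insert_mem:
  assumes "composable V1 a V2" "g \<in> simple_graphs (insert a V1)" "h \<in> simple_graphs V2" 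
    "\<And>v. v \<in> neighbours g a \<Longrightarrow> f v \<in> V2"
  shows "graph_insert V1 a g h f \<in> simple_graphs (V1 \<union> V2)"
proof -
  have 1: "V2 \<noteq> {}" "fst h = V2" using assms(3) by (auto simp: simple_graphs_iff)
  have "\<exists>u v. e = {u,v} \<and> u \<in> V1 \<union> V2 \<and> v \<in> V1 \<union> V2 \<and> u \<noteq> v" 
    if e: "e \<in> {e \<in> snd g. e \<subseteq> V1} \<union> (\<lambda>v. {v, f v}) ` neighbours g a \<union> snd h" for e
  proof -
    consider "e \<in> snd g" "e \<subseteq> V1" | v where "v \<in> neighbours g a" "e = {v, f v}" | "e \<in> snd h"
      using e by blast
    then show ?thesis
    proof cases
      case 1
      then show ?thesis using edgeD[OF assms(2) 1(1)] by auto
    next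
      case (2 v)
      then have "v \<in> V1" using neighboursD[OF assms(2)] by blast
      moreover have "f v \<in> V2" using assms(4) 2 by blast
      moreover have "V1 \<inter> V2 = {}" using assms(1) by (auto simp: composable_def)
      ultimately show ?thesis using 2 by (intro exI[of _ v] exI[of _ "f v"]) auto
    next
      case 3
      then obtain u v where "e = {u,v}" "u \<in> V2" "v \<in> V2" "u \<noteq> v" using edgeD[OF assms(3) 3] by blast
      then show ?thesis by (intro exI[of _ u] exI[of _ v]) auto
    qed
  qed
  then show ?thesis using 1 by (simp add: simple_graphs_iff graph_insert_alt)
qed

lemma lin_ext_graph_comp:
  "lin_ext F (graph_comp V1 a V2 g h) = (\<Sum>f \<in> neighbours g a \<rightarrow>\<^sub>E V2. F (graph_insert V1 a g h f))"
  by (simp add: graph_comp_def lin_ext_sum)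

lemma neighbours_relabel:
  assumes "g \<in> simple_graphs W" "inj_on \<sigma> W" "a \<in> W"
  shows "neighbours (\<sigma> ` fst g, (`) \<sigma> ` snd g) (\<sigma> a) = \<sigma> ` neighbours g a"
proof -
  have "w \<in> \<sigma> ` neighbours g a" if w: "{w, \<sigma> a} \<in> (`) \<sigma> ` snd g" for w
  proof -
    obtain e where e: "{w, \<sigma> a} = \<sigma> ` e" "e \<in> snd g" using w by (rule imageE)
    obtain u v where uv: "e = {u,v}" "u \<in> W" "v \<in> W" "u \<noteq> v" using edgeD[OF assms(1) e(2)] by blast
    have "(w = \<sigma> u \<and> a = v) \<or> (w = \<sigma> v \<and> a = u)"
      using e(1) uv assms(2,3) by (auto simp: doubleton_eq_iff dest: inj_onD)
    then show ?thesis using e uv by (auto simp: neighbours_def insert_commute)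
  qed
  moreover have "{\<sigma> v, \<sigma> a} \<in> (`) \<sigma> ` snd g" if v: "v \<in> neighbours g a" for v
    using v unfolding neighbours_def by (intro image_eqI[of _ _ "{v, a}"]) auto
  ultimately show ?thesis unfolding neighbours_def[of "(_, _)"] snd_conv by blast
qed

lemma graph_nat:
  assumes "composable V1 a V2" "g \<in> simple_graphs (insert a V1)" "h \<in> simple_graphs V2"
    "inj_on \<sigma> (insert a V1)" "inj_on \<tau> V2" "inj_on \<rho> (V1 \<union> V2)"
    "\<And>v. v \<in> V1 \<Longrightarrow> \<rho> v = \<sigma> v" "\<And>v. v \<in> V2 \<Longrightarrow> \<rho> v = \<tau> v"
  defines "R \<equiv> (\<lambda>\<sigma> (g::'v sgraph). (\<sigma> ` fst g, image \<sigma> ` snd g))"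
  shows "lin_ext (\<lambda>k. Poly_Mapping.single (R \<rho> k) 1) (graph_comp V1 a V2 g h)
     = (graph_comp (\<sigma> ` V1) (\<sigma> a) (\<tau> ` V2) (R \<sigma> g) (R \<tau> h) :: 'v sgraph \<Rightarrow>\<^sub>0 'k::field)"
proof -
  let ?n = "neighbours g a"
  have nb: "neighbours (R \<sigma> g) (\<sigma> a) = \<sigma> ` ?n"
    unfolding R_def using neighbours_relabel[OF assms(2,4)] by simp
  have nV: "?n \<subseteq> V1" using neighboursD[OF assms(2)] by blast
  have inj: "inj_on \<sigma> ?n" using assms(4) nV by (auto simp: inj_on_def)
  define i where "i = (\<lambda>f'. \<lambda>v\<in>?n. inv_into V2 \<tau> (f' (\<sigma> v)))"
  define j where "j = (\<lambda>f. \<lambda>w\<in>\<sigma> ` ?n. \<tau> (f (inv_into ?n \<sigma> w)))"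
  have inv1: "inv_into ?n \<sigma> (\<sigma> v) = v" if "v \<in> ?n" for v using inj that by simp
  have inv2: "inv_into V2 \<tau> (\<tau> v) = v" if "v \<in> V2" for v using assms(5) that by simp
  have inv3: "\<tau> (inv_into V2 \<tau> w) = w" if "w \<in> \<tau> ` V2" for w using that by (rule f_inv_into_f)
  have inv4: "inv_into V2 \<tau> w \<in> V2" if "w \<in> \<tau> ` V2" for w using that by (rule inv_into_into)
  have h: "fst h = V2" "\<And>e. e \<in> snd h \<Longrightarrow> e \<subseteq> V2" using fst_simple[OF assms(3)] edgeD[OF assms(3)] by blast+
  have eq: "R \<rho> (graph_insert V1 a g h f) = graph_insert (\<sigma> ` V1) (\<sigma> a) (R \<sigma> g) (R \<tau> h) (j f)"
    if f: "f \<in> ?n \<rightarrow>\<^sub>E V2" for f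
  proof -
    have "\<rho> ` V1 = \<sigma> ` V1" "\<rho> ` V2 = \<tau> ` V2" using assms(7,8) by auto
    then have v: "\<rho> ` (V1 \<union> fst h) = \<sigma> ` V1 \<union> \<tau> ` fst h" using h by (simp add: image_Un)
    have e1: "(`) \<rho> ` {e \<in> snd g. e \<subseteq> V1} = {e \<in> (`) \<sigma> ` snd g. e \<subseteq> \<sigma> ` V1}"
    proof -
      have "e \<subseteq> V1" if "e \<in> snd g" "\<sigma> ` e \<subseteq> \<sigma> ` V1" for e
      proof -
        have "e \<subseteq> insert a V1" using edgeD[OF assms(2) that(1)] by auto
        moreover have "a \<notin> V1" using assms(1) by (simp add: composable_def)
        moreover have "a \<notin> e"
        proof
          assume "a \<in> e"
          then have "\<sigma> a \<in> \<sigma> ` V1" using that(2) by blast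
          then show False using \<open>a \<notin> V1\<close> assms(4) by (auto simp: inj_on_def)
        qed
        ultimately show ?thesis by blast
      qed
      moreover have "\<rho> ` e = \<sigma> ` e" if "e \<subseteq> V1" for e
        by (rule image_cong) (use assms(7) that in auto)
      moreover have "\<sigma> ` e \<subseteq> \<sigma> ` V1" if "e \<subseteq> V1" for e using that by blast
      ultimately have "{e \<in> (`) \<sigma> ` snd g. e \<subseteq> \<sigma> ` V1} = (`) \<sigma> ` {e \<in> snd g. e \<subseteq> V1}"
        by (intro equalityI subsetI) (auto simp del: image_subset_iff)
      also have "\<dots> = (`) \<rho> ` {e \<in> snd g. e \<subseteq> V1}"
        by (intro image_cong[OF refl]) (use assms(7) in auto)
      finally show ?thesis by simp
    qed
    have e2: "(`) \<rho> ` (\<lambda>v. {v, f v}) ` ?n = (\<lambda>v. {v, j f v}) ` \<sigma> ` ?n"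
      unfolding image_image
    proof (rule image_cong)
      fix v assume v: "v \<in> ?n"
      then have "f v \<in> V2" "v \<in> V1" using f nV by auto
      then show "\<rho> ` {v, f v} = {\<sigma> v, j f (\<sigma> v)}" using v assms(7,8) by (simp add: j_def inv1)
    qed simp
    have e3: "(`) \<rho> ` snd h = (`) \<tau> ` snd h"
    proof (rule image_cong)
      fix e assume "e \<in> snd h" 
      then show "\<rho> ` e = \<tau> ` e" using h(2)[of e] assms(8) by (intro image_cong) auto
    qed simp
    show ?thesis unfolding graph_insert_alt nb by (simp add: R_def v[unfolded image_Un] image_Un e1 e2 e3)
  qed
  show ?thesis
    unfolding lin_ext_graph_comp graph_comp_def[of "\<sigma> ` V1"] nb
  proof (rule sum.reindex_bij_witness[where i = i and j = j], goal_cases)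
    case (1 f)
    then show ?case by (auto simp: i_def j_def fun_eq_iff restrict_def inv1 inv2 PiE_def extensional_def Pi_def)
  next
    case (2 f)
    then show ?case by (auto simp: i_def j_def PiE_def Pi_def)  (use inv1 in auto)
  next
    case (3 f)
    then show ?case by (auto simp: i_def j_def fun_eq_iff restrict_def inv1 inv3 PiE_def extensional_def Pi_def)
  next
    case (4 f)
    then show ?case by (auto simp: i_def PiE_def Pi_def intro!: inv4)
  next
    case (5 f)
    then show ?case by (simp add: eq)
  qed
qed

lemma Collect_Un3: "{e \<in> A \<union> B \<union> C. P e} = {e \<in> A. P e} \<union> {e \<in> B. P e} \<union> {e \<in> C. P e}"
  by blast

lemma graph_seq:
  assumes "finite V1" "finite V2" "finite V3" "V1 \<inter> V2 = {}" "V1 \<inter> V3 = {}" "V2 \<inter> V3 = {}"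
    "a \<notin> V1" "b \<notin> V1" "b \<notin> V2"
    "x \<in> simple_graphs (insert a V1)" "y \<in> simple_graphs (insert b V2)" "z \<in> simple_graphs V3"
  shows "lin_ext (\<lambda>s. graph_comp (V1 \<union> V2) b V3 s z) (graph_comp V1 a (insert b V2) x y)
    = lin_ext (graph_comp V1 a (V2 \<union> V3) x) (graph_comp V2 b V3 y z :: 'v sgraph \<Rightarrow>\<^sub>0 'k::field)"
proof -
  let ?n = "neighbours x a" and ?m = "neighbours y b"
  have nV: "?n \<subseteq> V1" using neighboursD[OF assms(10)] by blast
  have mV: "?m \<subseteq> V2" using neighboursD[OF assms(11)] by blast
  have nm: "?n \<inter> ?m = {}" using nV mV assms(4) by blast
  have fin: "finite ?n" "finite ?m" using finite_subset[OF nV] finite_subset[OF mV] assms by auto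
  define N where "N = (\<lambda>f. ?m \<union> {v \<in> ?n. f v = b})"
  have N: "neighbours (graph_insert V1 a x y f) b = N f" if "f \<in> ?n \<rightarrow>\<^sub>E insert b V2" for f
  proof -
    have "v \<in> N f \<longleftrightarrow> {v, b} \<in> {e \<in> snd x. e \<subseteq> V1} \<union> (\<lambda>v. {v, f v}) ` ?n \<union> snd y" for v
    proof -
      have "{v, b} \<in> (\<lambda>v. {v, f v}) ` ?n \<longleftrightarrow> v \<in> ?n \<and> f v = b"
        using nV assms(8) by (auto simp: doubleton_eq_iff image_iff)
      then show ?thesis using assms(8) by (auto simp: N_def neighbours_def)
    qed
    then show ?thesis unfolding graph_insert_alt by (auto simp: neighbours_def)
  qed
  have fst: "fst y = insert b V2" "fst z = V3" using assms fst_simple by blast+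
  define G where "G = (\<lambda>f h. graph_insert (V1 \<union> V2) b (graph_insert V1 a x y f) z h)"
  define H where "H = (\<lambda>h f. graph_insert V1 a x (graph_insert V2 b y z h) f)"
  define j where "j = (\<lambda>(f, h). (restrict h ?m, \<lambda>v\<in>?n. if f v = b then h v else f v))"
  define i where "i = (\<lambda>(h, f). (\<lambda>v\<in>?n. if f v \<in> V3 then b else f v, 
     \<lambda>v\<in>?m \<union> {v\<in>?n. f v \<in> V3}. if v \<in> ?m then h v else f v))"
  have eq: "H (restrict h ?m) (\<lambda>v\<in>?n. if f v = b then h v else f v) = G f h"
    if f: "f \<in> ?n \<rightarrow>\<^sub>E insert b V2" and h: "h \<in> N f \<rightarrow>\<^sub>E V3" for f h
  proof -
    let ?A = "{e \<in> snd x. e \<subseteq> V1}" and ?C = "{e \<in> snd y. e \<subseteq> V2}"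
    let ?F1 = "(\<lambda>v. {v, f v}) ` {v \<in> ?n. f v \<noteq> b}" and ?F2 = "(\<lambda>v. {v, h v}) ` {v \<in> ?n. f v = b}"
    let ?M = "(\<lambda>v. {v, h v}) ` ?m"
    have "{e \<in> ?A \<union> (\<lambda>v. {v, f v}) ` ?n \<union> snd y. e \<subseteq> V1 \<union> V2} = ?A \<union> ?F1 \<union> ?C"
    proof -
      have "{e \<in> (\<lambda>v. {v, f v}) ` ?n. e \<subseteq> V1 \<union> V2} = ?F1"
        using nV f assms(8,9) by (auto simp: PiE_def Pi_def image_iff)
      moreover have "{e \<in> snd y. e \<subseteq> V1 \<union> V2} = ?C"
      proof -
        have "e \<subseteq> V2" if "e \<in> snd y" "e \<subseteq> V1 \<union> V2" for e
          using edgeD[OF assms(11) that(1)] that(2) assms(4,8) by auto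
        then show ?thesis by auto
      qed
      moreover have "{e \<in> ?A. e \<subseteq> V1 \<union> V2} = ?A" by blast
      ultimately show ?thesis unfolding Collect_Un3 by simp
    qed
    then have "snd (G f h) = ?A \<union> ?F1 \<union> ?C \<union> (?M \<union> ?F2) \<union> snd z"
      unfolding G_def graph_insert_alt[of "V1 \<union> V2"] N[OF f]
      by (simp add: graph_insert_alt N_def image_Un)
    moreover have "snd (H (restrict h ?m) (\<lambda>v\<in>?n. if f v = b then h v else f v)) = ?A \<union> (?F1 \<union> ?F2) \<union> (?C \<union> ?M \<union> snd z)"
    proof -
      have "(\<lambda>v. {v, (\<lambda>v\<in>?n. if f v = b then h v else f v) v}) ` ?n = ?F1 \<union> ?F2"
      proof -
        have "?n = {v \<in> ?n. f v \<noteq> b} \<union> {v \<in> ?n. f v = b}" by blast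
        then have "(\<lambda>v. {v, (\<lambda>v\<in>?n. if f v = b then h v else f v) v}) ` ?n = 
          (\<lambda>v. {v, (\<lambda>v\<in>?n. if f v = b then h v else f v) v}) ` {v \<in> ?n. f v \<noteq> b} \<union> 
          (\<lambda>v. {v, (\<lambda>v\<in>?n. if f v = b then h v else f v) v}) ` {v \<in> ?n. f v = b}"
          by (metis image_Un)
        also have "(\<lambda>v. {v, (\<lambda>v\<in>?n. if f v = b then h v else f v) v}) ` {v \<in> ?n. f v \<noteq> b} = ?F1"
          by (rule image_cong) simp_all
        also have "(\<lambda>v. {v, (\<lambda>v\<in>?n. if f v = b then h v else f v) v}) ` {v \<in> ?n. f v = b} = ?F2"
          by (rule image_cong) simp_all
        finally show ?thesis .
      qed
      moreover have "(\<lambda>v. {v, restrict h ?m v}) ` ?m = ?M" by (intro image_cong) auto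
      ultimately show ?thesis unfolding H_def by (simp add: graph_insert_alt)
    qed
    moreover have "fst (G f h) = fst (H h' f')" for h' f' by (auto simp: G_def H_def graph_insert_alt)
    ultimately show ?thesis by (intro prod_eqI) auto
  qed
  have "lin_ext (\<lambda>s. graph_comp (V1 \<union> V2) b V3 s z) (graph_comp V1 a (insert b V2) x y)
     = (\<Sum>f\<in>?n \<rightarrow>\<^sub>E insert b V2. \<Sum>h \<in> N f \<rightarrow>\<^sub>E V3. Poly_Mapping.single (G f h) (1::'k))"
    unfolding lin_ext_graph_comp by (rule sum.cong) (simp_all add: graph_comp_def N G_def)
  also have "\<dots> = (\<Sum>(f,h)\<in>(SIGMA f:?n \<rightarrow>\<^sub>E insert b V2. N f \<rightarrow>\<^sub>E V3). Poly_Mapping.single (G f h) 1)"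
    by (rule sum.Sigma) (use fin assms in \<open>auto simp: N_def intro!: finite_PiE\<close>)
  also have "\<dots> = (\<Sum>(h,f)\<in>(SIGMA h:?m \<rightarrow>\<^sub>E V3. ?n \<rightarrow>\<^sub>E V2 \<union> V3). Poly_Mapping.single (H h f) 1)"
  proof (rule sum.reindex_bij_witness[where i = i and j = j], goal_cases)
    case (1 p)
    obtain f h where p: "p = (f,h)" by (cases p)
    have f: "f \<in> ?n \<rightarrow>\<^sub>E insert b V2" and h: "h \<in> N f \<rightarrow>\<^sub>E V3" using 1 p by auto
    have a1: "(if f v = b then h v else f v) \<in> V3 \<longleftrightarrow> f v = b" if "v \<in> ?n" for v
    proof -
      have "f v = b \<Longrightarrow> h v \<in> V3" using h that by (auto simp: N_def)
      moreover have "f v \<noteq> b \<Longrightarrow> f v \<in> V2" using f that by auto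
      ultimately show ?thesis using assms(6) by auto
    qed
    have "(\<lambda>v\<in>?n. if (\<lambda>v\<in>?n. if f v = b then h v else f v) v \<in> V3 then b else (\<lambda>v\<in>?n. if f v = b then h v else f v) v) = f"
      using a1 f by (auto simp: fun_eq_iff restrict_def PiE_def extensional_def)
    moreover have "{v\<in>?n. (\<lambda>v\<in>?n. if f v = b then h v else f v) v \<in> V3} = {v \<in> ?n. f v = b}"
      using a1 by auto
    moreover have "(\<lambda>v\<in>?m \<union> {v \<in> ?n. f v = b}. if v \<in> ?m then restrict h ?m v else (\<lambda>v\<in>?n. if f v = b then h v else f v) v) = h"
      using h by (auto simp: fun_eq_iff restrict_def PiE_def extensional_def N_def)
    ultimately show ?case unfolding p j_def i_def prod.case by simp
  next
    case (2 p)
    then show ?case by (auto simp: j_def N_def PiE_def Pi_def split: prod.splits)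
  next
    case (3 p)
    obtain h f where p: "p = (h,f)" by (cases p)
    have f: "f \<in> ?n \<rightarrow>\<^sub>E V2 \<union> V3" and h: "h \<in> ?m \<rightarrow>\<^sub>E V3" using 3 p by auto
    have b: "f v \<in> V3" if "v \<in> ?n" "f v = b" for v using f that assms(9) by auto
    have "v \<in> ?n \<Longrightarrow> v \<notin> ?m" for v using nm by auto
    then show ?case using f h b unfolding p j_def i_def prod.case
      by (auto simp: fun_eq_iff restrict_def PiE_def extensional_def)
  next
    case (4 p)
    obtain h f where p: "p = (h,f)" by (cases p)
    have f: "f \<in> ?n \<rightarrow>\<^sub>E V2 \<union> V3" and h: "h \<in> ?m \<rightarrow>\<^sub>E V3" using 4 p by auto
    have b: "f v \<in> V3" if "v \<in> ?n" "f v = b" for v using f that assms(9) by auto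
    have "?m \<union> {v \<in> ?n. f v \<in> V3} = N (\<lambda>v\<in>?n. if f v \<in> V3 then b else f v)"
      using b by (auto simp: N_def)
    then show ?case using f h unfolding p i_def prod.case
      by (auto simp: PiE_def Pi_def extensional_def)
  next
    case (5 p)
    then show ?case using eq by (auto simp: j_def split: prod.splits)
  qed
  also have "\<dots> = (\<Sum>h\<in>?m \<rightarrow>\<^sub>E V3. \<Sum>f\<in>?n \<rightarrow>\<^sub>E V2 \<union> V3. Poly_Mapping.single (H h f) 1)"
    by (rule sum.Sigma[symmetric]) (use fin assms in \<open>auto intro!: finite_PiE\<close>)
  also have "\<dots> = lin_ext (graph_comp V1 a (V2 \<union> V3) x) (graph_comp V2 b V3 y z)"
    unfolding lin_ext_graph_comp by (simp add: graph_comp_def H_def)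
  finally show ?thesis .
qed

lemma graph_par_key:
  assumes "V1 \<inter> V2 = {}" "a \<noteq> b" "a \<notin> V1" "b \<notin> V1" "b \<notin> V2" 
    "x \<in> simple_graphs (insert a (insert b V1))" "y \<in> simple_graphs V2" "z \<in> simple_graphs V3"
  defines "n \<equiv> neighbours x a \<inter> V1" and "m \<equiv> neighbours x b \<inter> V1" and "c \<equiv> {a, b} \<in> snd x"
  shows "lin_ext (\<lambda>s. graph_comp (V1 \<union> V2) b V3 s z) (graph_comp (insert b V1) a V2 x y) =
     (\<Sum>f\<in>(n \<union> {v. v = b \<and> c}) \<rightarrow>\<^sub>E V2. \<Sum>h\<in>(m \<union> {v. v = f b \<and> c}) \<rightarrow>\<^sub>E V3.
       Poly_Mapping.single (V1 \<union> V2 \<union> V3, {e \<in> snd x. e \<subseteq> V1} \<union> (\<lambda>v. {v, f v}) ` n \<union> snd y \<union> 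
          (\<lambda>v. {v, h v}) ` (m \<union> {v. v = f b \<and> c}) \<union> snd z) (1::'k::field))"
proof -
  have na: "neighbours x a = n \<union> {v. v = b \<and> c}"
  proof -
    have "v \<in> V1 \<or> v = b" if "v \<in> neighbours x a" for v using neighboursD[OF assms(6) that] by blast
    moreover have "b \<in> neighbours x a \<longleftrightarrow> c" by (simp add: c_def neighbours_def insert_commute)
    ultimately show ?thesis using assms(4) unfolding n_def by blast
  qed
  have fst: "fst y = V2" "fst z = V3" using assms fst_simple by blast+
  have yV: "e \<subseteq> V2" if "e \<in> snd y" for e using edgeD[OF assms(7) that] by auto
  have nbs: "neighbours (graph_insert (insert b V1) a x y f) b = m \<union> {v. v = f b \<and> c}"
    if f: "f \<in> (n \<union> {v. v = b \<and> c}) \<rightarrow>\<^sub>E V2" for f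
  proof -
    have "{v, b} \<in> {e \<in> snd x. e \<subseteq> insert b V1} \<longleftrightarrow> v \<in> m" for v
    proof
      assume "{v, b} \<in> {e \<in> snd x. e \<subseteq> insert b V1}"
      then have "v \<in> neighbours x b" "v \<in> insert b V1" by (auto simp: neighbours_def)
      then show "v \<in> m" using neighboursD[OF assms(6), of v b] by (auto simp: m_def)
    qed (auto simp: m_def neighbours_def)
    moreover have "{v, b} \<in> (\<lambda>v. {v, f v}) ` (n \<union> {v. v = b \<and> c}) \<longleftrightarrow> v = f b \<and> c" for v
    proof
      assume "{v, b} \<in> (\<lambda>v. {v, f v}) ` (n \<union> {v. v = b \<and> c})"
      then obtain w where w: "w \<in> n \<union> {v. v = b \<and> c}" "{v, b} = {w, f w}" by blast
      then have "f w \<in> V2" using f by blast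
      then have "w = b \<and> v = f w" using w(2) assms(5) by (auto simp: doubleton_eq_iff)
      then show "v = f b \<and> c" using w(1) assms(4) by (auto simp: n_def)
    next
      assume "v = f b \<and> c"
      then have "{v, b} = {b, f b}" "b \<in> n \<union> {v. v = b \<and> c}" by auto
      then show "{v, b} \<in> (\<lambda>v. {v, f v}) ` (n \<union> {v. v = b \<and> c})" by (rule image_eqI)
    qed
    moreover have "{v, b} \<notin> snd y" for v using yV[of "{v,b}"] assms(5) by auto
    ultimately show ?thesis unfolding graph_insert_alt na neighbours_def[of "(_, _)"] by auto
  qed
  have eds: "{e \<in> {e \<in> snd x. e \<subseteq> insert b V1} \<union> (\<lambda>v. {v, f v}) ` (n \<union> {v. v = b \<and> c}) \<union> snd y. e \<subseteq> V1 \<union> V2} =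
    {e \<in> snd x. e \<subseteq> V1} \<union> (\<lambda>v. {v, f v}) ` n \<union> snd y"
    if f: "f \<in> (n \<union> {v. v = b \<and> c}) \<rightarrow>\<^sub>E V2" for f
  proof -
    have "{e \<in> {e \<in> snd x. e \<subseteq> insert b V1}. e \<subseteq> V1 \<union> V2} = {e \<in> snd x. e \<subseteq> V1}"
    proof -
      have "e \<subseteq> insert b V1 \<and> e \<subseteq> V1 \<union> V2 \<longleftrightarrow> e \<subseteq> V1" for e using assms(4,5) by blast
      then show ?thesis by simp
    qed
    moreover have "{e \<in> (\<lambda>v. {v, f v}) ` (n \<union> {v. v = b \<and> c}). e \<subseteq> V1 \<union> V2} = (\<lambda>v. {v, f v}) ` n"
    proof -
      have "{v, f v} \<subseteq> V1 \<union> V2" if "v \<in> n" for v using f that by (auto simp: n_def)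
      moreover have "\<not> {b, f b} \<subseteq> V1 \<union> V2" using assms(4,5) by auto
      ultimately show ?thesis by blast
    qed
    moreover have "{e \<in> snd y. e \<subseteq> V1 \<union> V2} = snd y" using yV by blast
    ultimately show ?thesis unfolding Collect_Un3 by simp
  qed
  show ?thesis
    unfolding lin_ext_graph_comp na
  proof (rule sum.cong, goal_cases)
    case (2 f)
    have "graph_insert (V1 \<union> V2) b (graph_insert (insert b V1) a x y f) z h = 
      (V1 \<union> V2 \<union> V3, {e \<in> snd x. e \<subseteq> V1} \<union> (\<lambda>v. {v, f v}) ` n \<union> snd y \<union> 
          (\<lambda>v. {v, h v}) ` (m \<union> {v. v = f b \<and> c}) \<union> snd z)" for h
      unfolding graph_insert_alt[of "V1 \<union> V2"] nbs[OF 2]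
      by (simp only: graph_insert_alt fst fst_conv snd_conv na eds[OF 2])
    then show ?case unfolding graph_comp_def nbs[OF 2] by simp
  qed simp
qed

lemma graph_par:
  assumes "finite V1" "finite V2" "finite V3" "V1 \<inter> V2 = {}" "V1 \<inter> V3 = {}" "V2 \<inter> V3 = {}"
    "a \<noteq> b" "a \<notin> V1" "b \<notin> V1" "b \<notin> V2" "a \<notin> V3"
    "x \<in> simple_graphs (insert a (insert b V1))" "y \<in> simple_graphs V2" "z \<in> simple_graphs V3"
  shows "lin_ext (\<lambda>s. graph_comp (V1 \<union> V2) b V3 s z) (graph_comp (insert b V1) a V2 x y) =
        lin_ext (\<lambda>s. graph_comp (V1 \<union> V3) a V2 s y) (graph_comp (insert a V1) b V3 x z :: 'v sgraph \<Rightarrow>\<^sub>0 'k::field)"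
proof -
  define n where "n = neighbours x a \<inter> V1"
  define m where "m = neighbours x b \<inter> V1"
  have fin: "finite n" "finite m" using assms by (auto simp: n_def m_def)
  have sub: "n \<subseteq> V1" "m \<subseteq> V1" by (auto simp: n_def m_def)
  have x': "x \<in> simple_graphs (insert b (insert a V1))" using assms(12) by (simp add: insert_commute)
  have c': "{b, a} \<in> snd x \<longleftrightarrow> {a, b} \<in> snd x" by (simp add: insert_commute)
  note L = graph_par_key[OF assms(4,7,8,9,10,12,13,14), where 'k = 'k, folded n_def m_def]
  note R = graph_par_key[OF assms(5) assms(7)[symmetric] assms(9,8,11) x' assms(14,13), where 'k = 'k, folded n_def m_def, unfolded c']
  show ?thesis
  proof (cases "{a, b} \<in> snd x")
    case False
    show ?thesis unfolding L R using False
      by (simp add: Un_ac) (subst sum.swap, simp add: Un_ac Un_left_commute)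
  next
    case True
    define E where "E = (\<lambda>f h (u::'v) w. (V1 \<union> V2 \<union> V3, insert {u, w} ({e \<in> snd x. e \<subseteq> V1} \<union> (\<lambda>v. {v, f v}) ` n \<union> (\<lambda>v. {v, h v}) ` m \<union> snd y \<union> snd z)))"
    define j where "j = (\<lambda>(f, h). (\<lambda>v\<in>insert a m. if v = a then h (f b) else h v, 
        \<lambda>v\<in>insert (h (f b)) n. if v \<in> n then f v else f b :: 'v))"
    define i where "i = (\<lambda>(h, f). (\<lambda>v\<in>insert b n. if v = b then f (h a) else f v, 
        \<lambda>v\<in>insert (f (h a)) m. if v \<in> m then h v else h a :: 'v))"
    have L': "lin_ext (\<lambda>s. graph_comp (V1 \<union> V2) b V3 s z) (graph_comp (insert b V1) a V2 x y) =
      (\<Sum>(f,h)\<in>(SIGMA f:insert b n \<rightarrow>\<^sub>E V2. insert (f b) m \<rightarrow>\<^sub>E V3). Poly_Mapping.single (E f h (f b) (h (f b))) (1::'k))"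
      unfolding L using True fin assms(2,3)
      by (subst sum.Sigma[symmetric]) (auto simp: E_def Un_ac intro!: finite_PiE)
    have R': "lin_ext (\<lambda>s. graph_comp (V1 \<union> V3) a V2 s y) (graph_comp (insert a V1) b V3 x z) =
      (\<Sum>(h,f)\<in>(SIGMA h:insert a m \<rightarrow>\<^sub>E V3. insert (h a) n \<rightarrow>\<^sub>E V2). Poly_Mapping.single (E f h (h a) (f (h a))) (1::'k))"
      unfolding R using True fin assms(2,3)
      by (subst sum.Sigma[symmetric]) (auto simp: E_def Un_ac intro!: finite_PiE)
    have nn: "a \<notin> n" "b \<notin> n" "a \<notin> m" "b \<notin> m" using sub assms by auto
    have dis: "v \<notin> n" "v \<notin> m" if "v \<in> V2 \<union> V3" for v using sub assms that by auto
    show ?thesis unfolding L' R'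
    proof (rule sum.reindex_bij_witness[where i = i and j = j], goal_cases)
      case (1 p)
      obtain f h where p: "p = (f,h)" by (cases p)
      have f: "f \<in> insert b n \<rightarrow>\<^sub>E V2" and h: "h \<in> insert (f b) m \<rightarrow>\<^sub>E V3" using 1 p by auto
      have d: "f b \<notin> n" "f b \<notin> m" "h (f b) \<notin> n" "h (f b) \<notin> m" using f h dis by auto
      show ?case using f h d nn unfolding p j_def i_def prod.case
        by (auto simp: fun_eq_iff restrict_def PiE_def extensional_def)
    next
      case (2 p)
      obtain f h where p: "p = (f,h)" by (cases p)
      have f: "f \<in> insert b n \<rightarrow>\<^sub>E V2" and h: "h \<in> insert (f b) m \<rightarrow>\<^sub>E V3" using 2 p by auto
      show ?case using f h unfolding p j_def prod.case by (auto simp: PiE_def Pi_def)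
    next
      case (3 p)
      obtain f h where p: "p = (h,f)" by (cases p)
      have h: "h \<in> insert a m \<rightarrow>\<^sub>E V3" and f: "f \<in> insert (h a) n \<rightarrow>\<^sub>E V2" using 3 p by auto
      have d: "h a \<notin> n" "h a \<notin> m" "f (h a) \<notin> n" "f (h a) \<notin> m" using f h dis by auto
      show ?case using f h d nn unfolding p j_def i_def prod.case
        by (auto simp: fun_eq_iff restrict_def PiE_def extensional_def)
    next
      case (4 p)
      obtain f h where p: "p = (h,f)" by (cases p)
      have h: "h \<in> insert a m \<rightarrow>\<^sub>E V3" and f: "f \<in> insert (h a) n \<rightarrow>\<^sub>E V2" using 4 p by auto
      show ?case using f h unfolding p i_def prod.case by (auto simp: PiE_def Pi_def)
    next
      case (5 p)
      obtain f h where p: "p = (f,h)" by (cases p)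
      have f: "f \<in> insert b n \<rightarrow>\<^sub>E V2" and h: "h \<in> insert (f b) m \<rightarrow>\<^sub>E V3" using 5 p by auto
      have d: "f b \<notin> n" "f b \<notin> m" "h (f b) \<notin> n" "h (f b) \<notin> m" using f h dis by auto
      have e: "(\<lambda>v. {v, fst (j p) v}) ` m = (\<lambda>v. {v, h v}) ` m" "(\<lambda>v. {v, snd (j p) v}) ` n = (\<lambda>v. {v, f v}) ` n"
        "fst (j p) a = h (f b)" "snd (j p) (h (f b)) = f b"
        using nn d by (auto simp: p j_def intro!: image_cong)
      have "E (snd (j p)) (fst (j p)) (fst (j p) a) (snd (j p) (fst (j p) a)) = E f h (f b) (h (f b))"
        unfolding E_def e by (simp add: insert_commute)
      then show ?case by (simp add: p split_beta)
    qed
  qed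
qed

lemma operad_Graph_operad: "operad (Graph_operad :: ('v, 'k::field, _) operad)"
  unfolding Graph_operad_def
proof (rule basis_operadI, goal_cases)
  case (1 V \<sigma> g)
  have "\<exists>u v. \<sigma> ` e = {u, v} \<and> u \<in> \<sigma> ` V \<and> v \<in> \<sigma> ` V \<and> u \<noteq> v" if e: "e \<in> snd g" for e
  proof -
    obtain u v where "e = {u,v}" "u \<in> V" "v \<in> V" "u \<noteq> v" using edgeD[OF 1(3) e] by blast
    then show ?thesis using 1(2) by (intro exI[of _ "\<sigma> u"] exI[of _ "\<sigma> v"]) (auto dest: inj_onD)
  qed
  then show ?case using 1 by (auto simp: simple_graphs_iff split_beta)
next
  case (2 V \<sigma> \<tau> g)
  have "\<sigma> ` e = \<tau> ` e" if e: "e \<in> snd g" for e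
    using edgeD[OF 2(4) e] 2(3) by auto
  then show ?case using fst_simple[OF 2(4)] 2(3) by (auto simp: split_beta intro!: image_cong)
next
  case 3 then show ?case by (auto simp: split_beta)
next
  case 4 then show ?case by (auto simp: split_beta image_comp comp_def)
next
  case 5 then show ?case by (simp add: simple_graphs_def)
next
  case 6 then show ?case by (simp add: simple_graphs_def)
next
  case 7 then show ?case by simp
next
  case (8 V1 a V2 g h)
  then show ?case unfolding graph_comp_def by (auto intro!: sum_mem graph_insert_mem)
next
  case (9 V1 a V2 g h \<sigma> \<tau> \<rho>)
  then show ?case using graph_nat[OF 9] by (simp add: split_beta)
next
  case 10 then show ?case by (rule graph_seq)
next
  case 11 then show ?case by (rule graph_par)
next
  case (12 V a v g)
  let ?n = "neighbours g a" and ?s = "id(a := v)"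
  have nV: "?n \<subseteq> V" using neighboursD[OF 12(4)] by blast
  have s: "?s ` V = V" using 12(2) by (auto simp: image_iff)
  have "snd g = {e \<in> snd g. e \<subseteq> V} \<union> (\<lambda>v. {v, a}) ` ?n"
  proof -
    have "e \<subseteq> V \<or> e \<in> (\<lambda>v. {v, a}) ` ?n" if e: "e \<in> snd g" for e
    proof -
      obtain u w where uw: "e = {u, w}" "u \<in> insert a V" "w \<in> insert a V" "u \<noteq> w" using edgeD[OF 12(4) e] by blast
      show ?thesis
      proof (cases "u = a")
        case True
        then have "w \<in> ?n" "e = {w, a}" using e uw by (auto simp: neighbours_def insert_commute)
        then show ?thesis by blast
      next
        case False
        then show ?thesis using e uw by (cases "w = a") (auto simp: neighbours_def)
      qed
    qed
    then show ?thesis by (auto simp: neighbours_def)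
  qed
  then have "(`) ?s ` snd g = (`) ?s ` {e \<in> snd g. e \<subseteq> V} \<union> (`) ?s ` (\<lambda>v. {v, a}) ` ?n" by (metis image_Un)
  also have "(`) ?s ` {e \<in> snd g. e \<subseteq> V} = {e \<in> snd g. e \<subseteq> V}"
  proof -
    have "?s ` e = e" if "e \<subseteq> V" for e using that 12(2) by (auto simp: image_iff subset_iff)
    then have "(`) ?s ` {e \<in> snd g. e \<subseteq> V} = id ` {e \<in> snd g. e \<subseteq> V}" by (intro image_cong) auto
    then show ?thesis by simp
  qed
  also have "(`) ?s ` (\<lambda>v. {v, a}) ` ?n = (\<lambda>w. {w, v}) ` ?n"
    unfolding image_image using nV 12(2) by (intro image_cong) auto
  finally have e: "(`) ?s ` snd g = {e \<in> snd g. e \<subseteq> V} \<union> (\<lambda>w. {w, v}) ` ?n" .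
  have "graph_comp V a {v} g ({v}, {}) = Poly_Mapping.single (graph_insert V a g ({v}, {}) (\<lambda>w\<in>?n. v)) (1::'k)"
  proof -
    have "?n \<rightarrow>\<^sub>E {v} = {\<lambda>w\<in>?n. v}" by (auto simp: PiE_def Pi_def extensional_def fun_eq_iff)
    then show ?thesis by (simp add: graph_comp_def)
  qed
  also have "graph_insert V a g ({v}, {}) (\<lambda>w\<in>?n. v) = (?s ` fst g, (`) ?s ` snd g)"
    unfolding graph_insert_alt e using fst_simple[OF 12(4)] s 
    by (auto simp: image_iff)
  finally show ?case by (simp add: split_beta)
next
  case (13 V a g)
  have "neighbours ({a}, {}) a = {}" by (simp add: neighbours_def)
  then show ?case using fst_simple[OF 13(2)] by (simp add: graph_comp_def graph_insert_alt) (metis prod.collapse)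
qed

end

theory Submission
  imports Defs
begin

text \<open>
  Sending a tree to the sum of all graphs obtained by joining, at each inner node, a leaf of the one
  subtree to a leaf of the other defines a morphism from \<open>ComMag\<close> to \<open>Graph_operad\<close> with image
  \<open>Seg\<close>. It is injective because the top inner node can be recovered: the coefficient of a spanning
  tree \<open>E\<close> is \<open>\<Sum>\<^sub>e A (E - e)\<close>, where \<open>A\<close> is a function on spanning forests with two components, and
  \<open>A\<close> is determined by these sums in characteristic \<open>0\<close>. Indeed, if all of them vanish, then for a
  vertex \<open>l\<close> and two other vertices \<open>u, u'\<close> the function \<open>F \<mapsto> A (F + lu) - A (F + lu')\<close> on the
  forests without \<open>l\<close> inherits this property, hence is \<open>0\<close> by induction. So \<open>A\<close> does not change when
  a leaf is moved to another vertex, even of the other component. Every forest can thus be turned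
  into an isolated vertex and a star on the remaining vertices, and the sum for the star on all \<open>n\<close>
  vertices shows that \<open>(n - 1) A = 0\<close>. For a linear relation between the images of trees, the
  vanishing of \<open>A\<close> splits it into relations between products of images of the two subtrees, one for
  each splitting of the leaves, to which induction applies.
\<close>

section \<open>Functions on spanning forests with two components\<close>

text \<open>A spanning tree is grown from one vertex by attaching leaves. Connectedness and
  acyclicity are thus built in, and every proof on trees becomes an induction on the last
  leaf.\<close>

inductive tree_edges :: "'v set \<Rightarrow> 'v set set \<Rightarrow> bool" where
  single: "tree_edges {v} {}"
| leaf: "\<lbrakk>tree_edges V E; l \<notin> V; u \<in> V\<rbrakk> \<Longrightarrow> tree_edges (insert l V) (insert {l, u} E)"

inductive forest2_edges :: "'v set \<Rightarrow> 'v set set \<Rightarrow> bool" where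
  isolated: "a \<noteq> b \<Longrightarrow> forest2_edges {a, b} {}"
| leaf: "\<lbrakk>forest2_edges V F; l \<notin> V; u \<in> V\<rbrakk> \<Longrightarrow> forest2_edges (insert l V) (insert {l, u} F)"

lemma tree_edges_finite: "tree_edges V E \<Longrightarrow> finite V \<and> finite E \<and> V \<noteq> {}"
  by (induction rule: tree_edges.induct) auto

text \<open>Nonempty edges matter later: an edge of one of two trees on disjoint vertex sets cannot
  lie inside the other vertex set.\<close>

lemma tree_edges_subset: "tree_edges V E \<Longrightarrow> e \<in> E \<Longrightarrow> e \<subseteq> V \<and> e \<noteq> {}"
  by (induction rule: tree_edges.induct) auto

lemma forest2_edges_finite: "forest2_edges V F \<Longrightarrow> finite V \<and> finite F"
  by (induction rule: forest2_edges.induct) auto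

lemma forest2_edges_add_leaf:
  "\<lbrakk>forest2_edges (V - {l}) F; l \<in> V; u \<in> V - {l}\<rbrakk> \<Longrightarrow> forest2_edges V (insert {l, u} F)"
  using forest2_edges.leaf[of "V - {l}" F l u] by (simp add: insert_absorb)

text \<open>Connectedness in terms of cuts. If the old vertices already lie on both sides, an old
  edge crosses; otherwise the new leaf is alone on its side and its edge crosses.\<close>

lemma tree_edges_crossing:
  assumes "tree_edges V E" "V \<inter> X \<noteq> {}" "V - X \<noteq> {}"
  shows "\<exists>e\<in>E. e \<inter> X \<noteq> {} \<and> e - X \<noteq> {}"
  using assms
proof (induction rule: tree_edges.induct)
  case (leaf V E l u)
  show ?case
  proof (cases "V \<inter> X \<noteq> {} \<and> V - X \<noteq> {}")
    case False
    then have "l \<in> X \<longleftrightarrow> u \<notin> X" using leaf.hyps leaf.prems by blast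
    then show ?thesis by auto
  qed (use leaf.IH in auto)
qed auto

text \<open>First grow the tree on \<open>V\<close> beside a single vertex of \<open>W\<close>, then
  attach the remaining vertices of \<open>W\<close> in the order in which its tree was
  built.\<close>

lemma tree_edges_Un_forest2:
  assumes "tree_edges V E" "tree_edges W F" "V \<inter> W = {}"
  shows "forest2_edges (V \<union> W) (E \<union> F)"
  using assms(2,1,3)
proof (induction arbitrary: V E rule: tree_edges.induct)
  case (single w)
  then show ?case
  proof (induction rule: tree_edges.induct)
    case (single v)
    then show ?case using forest2_edges.isolated[of v w] by (simp add: insert_commute)
  next
    case (leaf V E l u)
    then have "forest2_edges (insert l (V \<union> {w})) (insert {l, u} (E \<union> {}))"
      by (intro forest2_edges.leaf) auto
    then show ?case by (simp add: insert_commute)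
  qed
next
  case (leaf W F l u)
  then show ?case using forest2_edges.leaf[of "V \<union> W" "E \<union> F" l u] by auto
qed

section \<open>Stars\<close>

definition star :: "'v \<Rightarrow> 'v set \<Rightarrow> 'v set set" where
  "star w U = (\<lambda>v. {v, w}) ` (U - {w})"

lemma star_insert: "l \<noteq> w \<Longrightarrow> star w (insert l U) = insert {l, w} (star w U)"
  by (auto simp: star_def)

lemma star_remove: "l \<in> U \<Longrightarrow> l \<noteq> w \<Longrightarrow> star w U = insert {l, w} (star w (U - {l}))"
  using star_insert[of l w "U - {l}"] by (simp add: insert_absorb)

lemma tree_edges_star:
  assumes "finite U" shows "w \<notin> U \<Longrightarrow> tree_edges (insert w U) (star w (insert w U))"
  using assms
proof (induction U rule: finite_induct)
  case empty
  then show ?case by (simp add: star_def tree_edges.single)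
next
  case (insert x F)
  then have "tree_edges (insert x (insert w F)) (insert {x, w} (star w (insert w F)))"
    by (intro tree_edges.leaf) auto
  moreover have "star w (insert x (insert w F)) = insert {x, w} (star w (insert w F))"
    using insert by (intro star_insert) auto
  ultimately show ?case by (simp add: insert_commute)
qed

lemma forest2_edges_star:
  assumes "finite U" shows "m \<noteq> w \<Longrightarrow> m \<notin> U \<Longrightarrow> w \<notin> U \<Longrightarrow>
    forest2_edges (insert m (insert w U)) (star w (insert w U))"
  using assms
proof (induction U rule: finite_induct)
  case empty
  then show ?case using forest2_edges.isolated[of m w] by (simp add: star_def)
next
  case (insert x F)
  then have "forest2_edges (insert x (insert m (insert w F))) (insert {x, w} (star w (insert w F)))"
    by (intro forest2_edges.leaf) auto
  moreover have "star w (insert x (insert w F)) = insert {x, w} (star w (insert w F))"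
    using insert by (intro star_insert) auto
  ultimately show ?case by (simp add: insert_commute)
qed

text \<open>The normal form of a forest with two components: \<open>m\<close> is isolated and
  \<open>w\<close> is the centre of a star on all other vertices.\<close>

lemma forest2_edges_star':
  assumes "finite U" "m \<in> U" "w \<in> U" "m \<noteq> w"
  shows "forest2_edges U (star w (U - {m}))"
proof -
  have "insert w (U - {m, w}) = U - {m}" "insert m (U - {m}) = U" using assms by auto
  then show ?thesis using forest2_edges_star[of "U - {m, w}" m w] assms by simp
qed

section \<open>Functions on forests that do not change when a leaf is moved\<close>

definition leaf_invariant :: "'v set \<Rightarrow> ('v set set \<Rightarrow> 'k) \<Rightarrow> bool" where
  "leaf_invariant V A \<longleftrightarrow> (\<forall>l F u u'. l \<in> V \<longrightarrow> forest2_edges (V - {l}) F \<longrightarrow> u \<in> V - {l} \<longrightarrow>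
     u' \<in> V - {l} \<longrightarrow> A (insert {l, u} F) = A (insert {l, u'} F))"

lemma leaf_invariantD:
  "\<lbrakk>leaf_invariant V A; l \<in> V; forest2_edges (V - {l}) F; u \<in> V - {l}; u' \<in> V - {l}\<rbrakk> \<Longrightarrow>
    A (insert {l, u} F) = A (insert {l, u'} F)"
  unfolding leaf_invariant_def by blast

text \<open>A leaf \<open>k\<close> of the smaller forest is no longer a leaf if
  \<open>u = k\<close>, because \<open>l\<close> hangs on it. So \<open>l\<close> is first moved to
  \<open>v\<close>, which differs from \<open>k\<close>; then \<open>k\<close> is moved from
  \<open>v\<close> to \<open>v'\<close>, and finally \<open>l\<close> goes back to
  \<open>u\<close>.\<close>

lemma leaf_invariant_insert:
  assumes A: "leaf_invariant (insert l V) A" and l: "l \<notin> V" "u \<in> V"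
  shows "leaf_invariant V (\<lambda>F. A (insert {l, u} F))"
  unfolding leaf_invariant_def
proof (intro allI impI)
  fix k F v v'
  assume k: "k \<in> V" and F: "forest2_edges (V - {k}) F" and v: "v \<in> V - {k}" and v': "v' \<in> V - {k}"
  have kl: "k \<noteq> l" using k l by auto
  have V: "insert l V - {l} = V" "insert l V - {k} = insert l (V - {k})" using l kl by auto
  have move_l: "A (insert {l, u} (insert {k, y} F)) = A (insert {l, v} (insert {k, y} F))"
    if "y \<in> V - {k}" for y
    by (rule leaf_invariantD[OF A])
      (use forest2_edges_add_leaf[OF F k that] l k v that in \<open>auto simp: V\<close>)
  have "A (insert {k, v} (insert {l, v} F)) = A (insert {k, v'} (insert {l, v} F))"
  proof (rule leaf_invariantD[OF A])
    show "forest2_edges (insert l V - {k}) (insert {l, v} F)"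
      unfolding V by (rule forest2_edges.leaf[OF F]) (use v l in auto)
  qed (use k v v' kl in auto)
  then show "A (insert {l, u} (insert {k, v} F)) = A (insert {l, u} (insert {k, v'} F))"
    unfolding move_l[OF v] move_l[OF v'] by (simp add: insert_commute)
qed

text \<open>Keep the last leaf edge fixed while the rest is brought to normal form by induction,
  then move this leaf to the centre of the star.\<close>

lemma leaf_invariant_star:
  assumes "forest2_edges V F" "leaf_invariant V A"
  shows "\<exists>w m. w \<in> V \<and> m \<in> V \<and> w \<noteq> m \<and> A F = A (star w (V - {m}))"
  using assms
proof (induction arbitrary: A rule: forest2_edges.induct)
  case (isolated a b)
  then show ?case by (intro exI[of _ a] exI[of _ b]) (auto simp: star_def)
next
  case (leaf V F l u)
  obtain w m where wm: "w \<in> V" "m \<in> V" "w \<noteq> m"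
    and eq: "A (insert {l, u} F) = A (insert {l, u} (star w (V - {m})))"
    using leaf.IH[OF leaf_invariant_insert[OF leaf.prems leaf.hyps(2,3)]] by blast
  have fin: "finite V" using leaf.hyps(1) forest2_edges_finite by blast
  have "A (insert {l, u} (star w (V - {m}))) = A (insert {l, w} (star w (V - {m})))"
    by (rule leaf_invariantD[OF leaf.prems])
      (use leaf.hyps wm fin in \<open>auto simp: forest2_edges_star'\<close>)
  also have "insert {l, w} (star w (V - {m})) = star w (insert l V - {m})"
    using star_insert[of l w "V - {m}"] leaf.hyps wm by (auto simp: insert_Diff_if)
  finally show ?case using wm eq by auto
qed

text \<open>The isolated vertex can be exchanged: move \<open>k\<close> from the centre to the
  isolated \<open>l\<close>, read the edge between them as the leaf \<open>l\<close> hanging on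
  \<open>k\<close>, and move \<open>l\<close> to the centre.\<close>

lemma leaf_invariant_star_eq:
  assumes A: "leaf_invariant V A" and "finite V" and l: "l \<in> V" "k \<in> V" "w \<in> V" "l \<noteq> w" "k \<noteq> w"
  shows "A (star w (V - {l})) = A (star w (V - {k}))"
proof (cases "l = k")
  case False
  let ?S = "star w (V - {l} - {k})"
  have S: "?S = star w (V - {k} - {l})" by (simp add: Diff_insert2[symmetric] insert_commute)
  have "star w (V - {l}) = insert {k, w} ?S" "star w (V - {k}) = insert {l, w} ?S"
    using l False star_remove[of k "V - {l}" w] star_remove[of l "V - {k}" w] unfolding S[symmetric]
    by auto
  moreover have "A (insert {k, w} ?S) = A (insert {k, l} ?S)"
    by (rule leaf_invariantD[OF A])
      (use forest2_edges_star'[of "V - {k}" l w] assms False in \<open>auto simp: S\<close>)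
  moreover have "A (insert {l, k} ?S) = A (insert {l, w} ?S)"
    by (rule leaf_invariantD[OF A])
      (use forest2_edges_star'[of "V - {l}" k w] assms False in auto)
  ultimately show ?thesis by (simp add: insert_commute)
qed simp

text \<open>The induction must cover all functions \<open>A\<close> at once, since its step applies
  the hypothesis to a difference of two functions derived from \<open>A\<close>.\<close>

lemma forest2_function_eq_0:
  fixes A :: "'v set set \<Rightarrow> 'k::field_char_0"
  assumes "finite V" "\<And>E. tree_edges V E \<Longrightarrow> (\<Sum>e\<in>E. A (E - {e})) = 0" "forest2_edges V F"
  shows "A F = 0"
  using assms
proof (induction V arbitrary: A F rule: finite_psubset_induct)
  case (psubset V)
  have inv: "leaf_invariant V A"
    unfolding leaf_invariant_def
  proof (intro allI impI)
    fix l F u u'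
    assume l: "l \<in> V" and F: "forest2_edges (V - {l}) F" and u: "u \<in> V - {l}" "u' \<in> V - {l}"
    let ?D = "\<lambda>F. A (insert {l, u} F) - A (insert {l, u'} F)"
    have V: "insert l (V - {l}) = V" using l by auto
    have "(\<Sum>e\<in>E. ?D (E - {e})) = 0" if E: "tree_edges (V - {l}) E" for E
    proof -
      \<comment> \<open>In the vanishing sum for the tree with the extra leaf edge, deleting that
        edge contributes \<open>A E\<close>. This does not depend on \<open>y\<close>, so it cancels
        in \<open>?D\<close>.\<close>
      have "(\<Sum>e\<in>E. A (insert {l, y} (E - {e}))) = - A E" if y: "y \<in> V - {l}" for y
      proof -
        have lE: "{l, y} \<notin> E" using tree_edges_subset[OF E] by blast
        have "0 = (\<Sum>e\<in>insert {l, y} E. A (insert {l, y} E - {e}))"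
          using psubset.prems(1)[of "insert {l, y} E"] tree_edges.leaf[OF E _ y, of l] V by simp
        also have "\<dots> = A E + (\<Sum>e\<in>E. A (insert {l, y} E - {e}))"
          using lE tree_edges_finite[OF E] by simp
        also have "(\<Sum>e\<in>E. A (insert {l, y} E - {e})) = (\<Sum>e\<in>E. A (insert {l, y} (E - {e})))"
          using lE by (intro sum.cong refl arg_cong[of _ _ A]) auto
        finally show ?thesis by (simp add: eq_neg_iff_add_eq_0 add.commute)
      qed
      then show ?thesis using u by (simp add: sum_subtractf)
    qed
    then have "?D F = 0" using psubset.IH[of "V - {l}" ?D F, OF _ _ F] l by auto
    then show "A (insert {l, u} F) = A (insert {l, u'} F)" by simp
  qed
  obtain w m where wm: "w \<in> V" "m \<in> V" "w \<noteq> m" and eq: "A F = A (star w (V - {m}))"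
    using leaf_invariant_star[OF psubset.prems(2) inv] by blast
  have V: "insert w (V - {w}) = V" using wm by auto
  \<comment> \<open>Deleting an edge of the star on all of \<open>V\<close> isolates one outer
    vertex, so every term of this sum is a normal form with centre \<open>w\<close> and has the
    value \<open>A F\<close>.\<close>
  have "0 = (\<Sum>e\<in>star w V. A (star w V - {e}))"
    using psubset.prems(1) tree_edges_star[of "V - {w}" w] psubset.hyps V by simp
  also have "\<dots> = (\<Sum>v\<in>V - {w}. A (star w V - {{v, w}}))"
    unfolding star_def by (subst sum.reindex) (auto simp: inj_on_def doubleton_eq_iff)
  also have "\<dots> = (\<Sum>v\<in>V - {w}. A (star w (V - {v})))"
    by (intro sum.cong refl arg_cong[of _ _ A]) (auto simp: star_def doubleton_eq_iff)
  also have "\<dots> = (\<Sum>v\<in>V - {w}. A F)"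
    unfolding eq by (intro sum.cong refl leaf_invariant_star_eq[OF inv]) (use wm psubset.hyps in auto)
  finally have "of_nat (card (V - {w})) * A F = 0" by simp
  \<comment> \<open>The vertex \<open>m\<close> lies in \<open>V - {w}\<close>; in characteristic 0
    the number of terms can therefore be cancelled.\<close>
  moreover have "card (V - {w}) \<noteq> 0" using wm psubset.hyps by (auto simp only: card_eq_0_iff)
  ultimately show ?case by (metis mult_eq_0_iff of_nat_eq_0_iff)
qed


section \<open>The graphs of a binary tree\<close>

definition bilinear_ext :: "('b \<Rightarrow> 'c \<Rightarrow> ('d \<Rightarrow>\<^sub>0 'k::field)) \<Rightarrow> ('b \<Rightarrow>\<^sub>0 'k) \<Rightarrow> ('c \<Rightarrow>\<^sub>0 'k) \<Rightarrow> ('d \<Rightarrow>\<^sub>0 'k)" where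
  "bilinear_ext f x y = lin_ext (\<lambda>g. lin_ext (f g) y) x"

lemma bilinear_ext_commute:
  "(\<And>g h. f g h = f h g) \<Longrightarrow> bilinear_ext f x y = bilinear_ext f y x"
  unfolding bilinear_ext_def by (subst lin_ext_swap) simp

lemma bilinear_ext_cong:
  "\<lbrakk>x \<in> free_space B; y \<in> free_space C; \<And>g h. g \<in> B \<Longrightarrow> h \<in> C \<Longrightarrow> f g h = f' g h\<rbrakk> \<Longrightarrow>
    bilinear_ext f x y = bilinear_ext f' x y"
  unfolding bilinear_ext_def by (auto intro!: lin_ext_cong')

lemma bilinear_ext_mem:
  "\<lbrakk>x \<in> free_space B; y \<in> free_space C; \<And>g h. g \<in> B \<Longrightarrow> h \<in> C \<Longrightarrow> f g h \<in> free_space D\<rbrakk> \<Longrightarrow>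
    bilinear_ext f x y \<in> free_space D"
  unfolding bilinear_ext_def by (auto intro!: lin_ext_mem)

lemma lookup_bilinear_ext:
  "Poly_Mapping.lookup (bilinear_ext f x y) k =
    (\<Sum>g\<in>Poly_Mapping.keys x. \<Sum>h\<in>Poly_Mapping.keys y.
      Poly_Mapping.lookup x g * Poly_Mapping.lookup y h * Poly_Mapping.lookup (f g h) k)"
  by (simp add: bilinear_ext_def lookup_lin_ext sum_distrib_left mult.assoc)

text \<open>For simple graphs on disjoint vertex sets this is the composition of a segment with
  \<open>g\<close> at one end and \<open>h\<close> at the other; see
  \<open>pcomp_segment\<close>.\<close>

definition join :: "'v sgraph \<Rightarrow> 'v sgraph \<Rightarrow> ('v sgraph \<Rightarrow>\<^sub>0 'k::field)" where
  "join g h = (\<Sum>(u, v)\<in>fst g \<times> fst h.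
     Poly_Mapping.single (fst g \<union> fst h, insert {u, v} (snd g \<union> snd h)) 1)"

lemma join_commute: "join g h = join h g"
  unfolding join_def
  by (rule sum.reindex_bij_witness[where i = prod.swap and j = prod.swap])
    (auto simp: Un_commute insert_commute)

text \<open>The children of a node form an unordered pair, so recursion through
  \<open>case_uprod\<close> requires an operation of type \<open>commute\<close>.\<close>

lift_definition glue :: "('v sgraph \<Rightarrow>\<^sub>0 'k::field, 'v sgraph \<Rightarrow>\<^sub>0 'k) commute" is "bilinear_ext join"
  by (intro allI bilinear_ext_commute join_commute)

lift_definition overlay :: "('v sgraph \<Rightarrow>\<^sub>0 'k::field, 'v set set \<Rightarrow>\<^sub>0 'k) commute" is
  "bilinear_ext (\<lambda>g h. Poly_Mapping.single (snd g \<union> snd h) 1)"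
  by (intro allI bilinear_ext_commute) (simp add: Un_commute)

primrec tree_graphs :: "'v ctree \<Rightarrow> ('v sgraph \<Rightarrow>\<^sub>0 'k::field)" where
  "tree_graphs (Leaf v) = Poly_Mapping.single ({v}, {}) 1"
| "tree_graphs (Node p) = case_uprod glue (map_uprod tree_graphs p)"

text \<open>At a node these coefficients are what a single tree contributes to the function
  \<open>A\<close> on forests: the edge joining the two subtrees at the root is left out.\<close>

primrec cut_graphs :: "'v ctree \<Rightarrow> ('v set set \<Rightarrow>\<^sub>0 'k::field)" where
  "cut_graphs (Leaf v) = 0"
| "cut_graphs (Node p) = case_uprod overlay (map_uprod tree_graphs p)"

lemma tree_graphs_Node:
  "tree_graphs (Node (Upair s t)) = bilinear_ext join (tree_graphs s) (tree_graphs t)"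
  by (simp add: glue.rep_eq)

lemma cut_graphs_Node:
  "cut_graphs (Node (Upair s t)) =
    bilinear_ext (\<lambda>g h. Poly_Mapping.single (snd g \<union> snd h) 1) (tree_graphs s) (tree_graphs t)"
  by (simp add: overlay.rep_eq)

declare tree_graphs.simps(2) [simp del] cut_graphs.simps(2) [simp del]

section \<open>The graphs of a binary tree are spanning trees\<close>

definition spanning_trees :: "'v set \<Rightarrow> 'v sgraph set" where
  "spanning_trees V = {(V, E) | E. tree_edges V E}"

lemma tree_edges_join:
  assumes "tree_edges V E" "tree_edges W F" "V \<inter> W = {}" "u \<in> V" "v \<in> W"
  shows "tree_edges (V \<union> W) (insert {u, v} (E \<union> F))"
  using assms(2,1,3-5)
proof (induction arbitrary: V E u v rule: tree_edges.induct)
  case (single w)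
  then show ?case using tree_edges.leaf[of V E w u] by (simp add: insert_commute)
next
  case (leaf W F l x)
  show ?case
  proof (cases "v = l")
    case False
    then have "tree_edges (insert l (V \<union> W)) (insert {l, x} (insert {u, v} (E \<union> F)))"
      using leaf by (intro tree_edges.leaf) auto
    then show ?thesis by (simp add: insert_commute)
  next
    case True
    txt \<open>Move the leaf \<open>l\<close> to the other side of the cut.\<close>
    have "tree_edges (insert l V) (insert {l, u} E)" using leaf by (intro tree_edges.leaf) auto
    then have "tree_edges (insert l V \<union> W) (insert {l, x} (insert {l, u} E \<union> F))"
      using leaf by (intro leaf.IH) auto
    then show ?thesis using True by (simp add: insert_commute)
  qed
qed

lemma join_mem:
  "\<lbrakk>g \<in> spanning_trees V; h \<in> spanning_trees W; V \<inter> W = {}\<rbrakk> \<Longrightarrow>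
    join g h \<in> free_space (spanning_trees (V \<union> W))"
  by (auto simp: join_def spanning_trees_def intro!: sum_mem tree_edges_join)

lemma tree_graphs_mem: "is_tree_on V t \<Longrightarrow> tree_graphs t \<in> free_space (spanning_trees V)"
proof (induction rule: is_tree_on.induct)
  case (Leaf v)
  then show ?case by (simp add: spanning_trees_def tree_edges.single)
next
  case (Node V s W t)
  then show ?case unfolding tree_graphs_Node by (auto intro!: bilinear_ext_mem join_mem)
qed

lemma lookup_tree_graphs_eq_0:
  "\<lbrakk>is_tree_on V t; \<not> tree_edges V E\<rbrakk> \<Longrightarrow> Poly_Mapping.lookup (tree_graphs t) (V, E) = 0"
  using tree_graphs_mem[of V t] by (auto simp: free_space_iff spanning_trees_def)

text \<open>Both sides count the same things: a pair of endpoints whose edge completes the two trees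
  to \<open>E\<close> corresponds to an edge of \<open>E\<close> whose deletion leaves exactly the
  two trees.\<close>

lemma lookup_join_eq_sum:
  assumes E: "tree_edges (V \<union> W) E" and disj: "V \<inter> W = {}"
    and g: "g \<in> spanning_trees V" and h: "h \<in> spanning_trees W"
  shows "Poly_Mapping.lookup (join g h) (V \<union> W, E) =
    (\<Sum>e\<in>E. Poly_Mapping.lookup (Poly_Mapping.single (snd g \<union> snd h) 1) (E - {e}) :: 'k::field)"
proof -
  let ?F = "snd g \<union> snd h"
  have fst: "fst g = V" "fst h = W" and tr: "tree_edges V (snd g)" "tree_edges W (snd h)"
    using g h by (auto simp: spanning_trees_def)
  have fin: "finite V" "finite W" "finite E" using tr E tree_edges_finite by blast+
  have F: "e \<subseteq> V \<or> e \<subseteq> W" if "e \<in> ?F" for e using tr tree_edges_subset that by blast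
  \<comment> \<open>Joining edges are new, so adding one and deleting it are inverse
    operations.\<close>
  have ne: "{u, v} \<notin> ?F" if "u \<in> V" "v \<in> W" for u v using F[of "{u, v}"] that disj by blast
  let ?P = "{p \<in> V \<times> W. insert {fst p, snd p} ?F = E}"
  have "Poly_Mapping.lookup (join g h) (V \<union> W, E) =
      (\<Sum>p\<in>V \<times> W. if insert {fst p, snd p} ?F = E then 1 else 0 :: 'k)"
    unfolding join_def lookup_sum fst
    by (intro sum.cong refl) (simp add: lookup_single when_def split_beta)
  also have "\<dots> = (\<Sum>p\<in>?P. 1)"
    using fin by (intro sum.inter_filter[symmetric]) simp
  also have "\<dots> = (\<Sum>e\<in>{e \<in> E. ?F = E - {e}}. 1)"
  proof (rule sum.reindex_bij_betw[where h = "\<lambda>p. {fst p, snd p}", OF bij_betw_imageI])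
    show "inj_on (\<lambda>p. {fst p, snd p}) ?P"
    proof (rule inj_onI)
      fix p q assume p: "p \<in> ?P" and q: "q \<in> ?P" and "{fst p, snd p} = {fst q, snd q}"
      then show "p = q" using disj by (auto simp: doubleton_eq_iff prod_eq_iff)
    qed
    show "(\<lambda>p. {fst p, snd p}) ` ?P = {e \<in> E. ?F = E - {e}}"
    proof (intro equalityI subsetI)
      fix e assume e: "e \<in> {e \<in> E. ?F = E - {e}}"
      \<comment> \<open>Some edge of \<open>E\<close> must cross from \<open>V\<close> to
        \<open>W\<close>. No edge of \<open>?F\<close> does, so it is the deleted edge
        \<open>e\<close>, which hence has one end on each side.\<close>
      obtain c where c: "c \<in> E" "c \<inter> V \<noteq> {}" "c - V \<noteq> {}"
        using tree_edges_crossing[OF E, of V] tree_edges_finite[OF tr(1)] tree_edges_finite[OF tr(2)]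
          disj by blast
      have cVW: "c \<subseteq> V \<union> W" using tree_edges_subset[OF E] c by blast
      then have "c \<notin> ?F" using F[of c] c disj by blast
      then have "c = e" using e c by blast
      moreover have "\<exists>x y. c = {x, y}" using E c(1) by (induction rule: tree_edges.induct) auto
      ultimately obtain x y where xy: "c = {x, y}" "e = {x, y}" by blast
      have "\<exists>u v. e = {u, v} \<and> u \<in> V \<and> v \<in> W"
      proof (cases "x \<in> V")
        case True
        then show ?thesis using c(2,3) cVW xy by blast
      next
        case False
        then have "y \<in> V" "x \<in> W" "e = {y, x}" using c(2) cVW xy by auto
        then show ?thesis by blast
      qed
      then obtain u v where uv: "e = {u, v}" "u \<in> V" "v \<in> W" by blast
      have "insert e ?F = E" using e by blast
      then have "(u, v) \<in> ?P" using uv by simp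
      then show "e \<in> (\<lambda>p. {fst p, snd p}) ` ?P" using uv by (intro image_eqI[of _ _ "(u, v)"]) auto
    next
      fix e assume "e \<in> (\<lambda>p. {fst p, snd p}) ` ?P"
      then obtain u v where uv: "e = {u, v}" "u \<in> V" "v \<in> W" "insert e ?F = E" by auto
      then show "e \<in> {e \<in> E. ?F = E - {e}}" using ne[of u v] by blast
    qed
  qed
  also have "\<dots> = (\<Sum>e\<in>E. if ?F = E - {e} then 1 else 0)"
    using fin by (intro sum.inter_filter) 
  also have "\<dots> = (\<Sum>e\<in>E. Poly_Mapping.lookup (Poly_Mapping.single ?F 1) (E - {e}))"
    by (simp add: lookup_single when_def)
  finally show ?thesis .
qed

text \<open>The bilinear form of \<open>lookup_join_eq_sum\<close>. It links the coefficients of a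
  tree to its cut coefficients, so that \<open>forest2_function_eq_0\<close> can be applied.\<close>

lemma lookup_tree_graphs_eq_sum:
  assumes "is_tree_on V s" "is_tree_on W t" "V \<inter> W = {}" "tree_edges (V \<union> W) E"
  shows "Poly_Mapping.lookup (tree_graphs (Node (Upair s t)) :: _ \<Rightarrow>\<^sub>0 'k::field) (V \<union> W, E) =
    (\<Sum>e\<in>E. Poly_Mapping.lookup (cut_graphs (Node (Upair s t))) (E - {e}))"
proof -
  let ?x = "tree_graphs s :: _ \<Rightarrow>\<^sub>0 'k" and ?y = "tree_graphs t :: _ \<Rightarrow>\<^sub>0 'k"
  have keys: "Poly_Mapping.keys ?x \<subseteq> spanning_trees V" "Poly_Mapping.keys ?y \<subseteq> spanning_trees W"
    using tree_graphs_mem[OF assms(1)] tree_graphs_mem[OF assms(2)] by (auto simp: free_space_def)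
  have "Poly_Mapping.lookup (tree_graphs (Node (Upair s t)) :: _ \<Rightarrow>\<^sub>0 'k) (V \<union> W, E) =
    (\<Sum>g\<in>Poly_Mapping.keys ?x. \<Sum>h\<in>Poly_Mapping.keys ?y. \<Sum>e\<in>E.
      Poly_Mapping.lookup ?x g * Poly_Mapping.lookup ?y h *
      Poly_Mapping.lookup (Poly_Mapping.single (snd g \<union> snd h) 1) (E - {e}))"
    unfolding tree_graphs_Node lookup_bilinear_ext
  proof (intro sum.cong refl)
    fix g h assume "g \<in> Poly_Mapping.keys ?x" "h \<in> Poly_Mapping.keys ?y"
    then have "g \<in> spanning_trees V" "h \<in> spanning_trees W" using keys by blast+
    then show "Poly_Mapping.lookup ?x g * Poly_Mapping.lookup ?y h * Poly_Mapping.lookup (join g h) (V \<union> W, E) =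
      (\<Sum>e\<in>E. Poly_Mapping.lookup ?x g * Poly_Mapping.lookup ?y h *
      Poly_Mapping.lookup (Poly_Mapping.single (snd g \<union> snd h) 1) (E - {e}))"
      using lookup_join_eq_sum[OF assms(4,3), of g h, where 'k = 'k]
      by (simp flip: sum_distrib_left)
  qed
  also have "\<dots> = (\<Sum>e\<in>E. \<Sum>g\<in>Poly_Mapping.keys ?x. \<Sum>h\<in>Poly_Mapping.keys ?y.
      Poly_Mapping.lookup ?x g * Poly_Mapping.lookup ?y h *
      Poly_Mapping.lookup (Poly_Mapping.single (snd g \<union> snd h) 1) (E - {e}))"
    by (subst (2) sum.swap) (subst sum.swap, rule refl)
  finally show ?thesis unfolding cut_graphs_Node lookup_bilinear_ext .
qed

section \<open>Binary trees with a given set of leaves\<close>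

lemma is_tree_on_NodeE:
  assumes "is_tree_on V t" "V \<noteq> {v}" "v \<in> V"
  obtains V1 V2 s1 s2 where "t = Node (Upair s1 s2)" "V = V1 \<union> V2" "V1 \<inter> V2 = {}"
    "is_tree_on V1 s1" "is_tree_on V2 s2"
  using assms by (cases rule: is_tree_on.cases) auto

lemma is_tree_on_singletonD:
  assumes "is_tree_on {v} t" shows "t = Leaf v"
  using assms
proof (cases rule: is_tree_on.cases)
  case (Node V s W t)
  then have "V \<subseteq> {v}" "W \<subseteq> {v}" "V \<noteq> {}" "W \<noteq> {}" "V \<inter> W = {}"
    using is_tree_on_nonempty by auto
  then show ?thesis by blast
qed auto

lemma is_tree_on_unique: "is_tree_on V t \<Longrightarrow> is_tree_on W t \<Longrightarrow> V = W"
  using is_tree_on_set by blast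

text \<open>Needed for linear relations, which are sums over all trees on \<open>V\<close>. A tree
  is a leaf or a node over trees on proper subsets of \<open>V\<close>.\<close>

lemma finite_trees:
  assumes "finite V" shows "finite {t. is_tree_on V t}"
  using assms
proof (induction V rule: finite_psubset_induct)
  case (psubset V)
  let ?T = "\<lambda>W. {t. is_tree_on W t}"
  let ?P = "{W. W \<subset> V}"
  have "?T V \<subseteq> Leaf ` V \<union> (\<lambda>(s, t). Node (Upair s t)) ` (\<Union>W\<in>?P. \<Union>W'\<in>?P. ?T W \<times> ?T W')"
  proof
    fix t assume "t \<in> ?T V"
    then have "is_tree_on V t" by simp
    then show "t \<in> Leaf ` V \<union> (\<lambda>(s, t). Node (Upair s t)) ` (\<Union>W\<in>?P. \<Union>W'\<in>?P. ?T W \<times> ?T W')"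
    proof (cases rule: is_tree_on.cases)
      case (Node W1 s1 W2 s2)
      then have "W1 \<subset> V" "W2 \<subset> V"
        using is_tree_on_nonempty[of W1 s1] is_tree_on_nonempty[of W2 s2] by auto
      then show ?thesis using Node by (intro UnI2 image_eqI[of _ _ "(s1, s2)"]) auto
    qed auto
  qed
  moreover have "finite ?P" by (rule finite_subset[of _ "Pow V"]) (use psubset.hyps in auto)
  ultimately show ?case using psubset by (auto intro: finite_subset)
qed

text \<open>Each of two trees on disjoint vertex sets is recovered from the union of their edges by
  restricting to its own vertices, so only one pair of terms contributes.\<close>

lemma lookup_cut_graphs:
  assumes "is_tree_on V s" "is_tree_on W t" "V \<inter> W = {}" "tree_edges V E" "tree_edges W F"
  shows "Poly_Mapping.lookup (cut_graphs (Node (Upair s t)) :: _ \<Rightarrow>\<^sub>0 'k::field) (E \<union> F) =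
    Poly_Mapping.lookup (tree_graphs s) (V, E) * Poly_Mapping.lookup (tree_graphs t) (W, F)"
proof -
  let ?x = "tree_graphs s :: _ \<Rightarrow>\<^sub>0 'k" and ?y = "tree_graphs t :: _ \<Rightarrow>\<^sub>0 'k"
  have keys: "Poly_Mapping.keys ?x \<subseteq> spanning_trees V" "Poly_Mapping.keys ?y \<subseteq> spanning_trees W"
    using tree_graphs_mem[OF assms(1)] tree_graphs_mem[OF assms(2)] by (auto simp: free_space_def)
  have split: "X = {e \<in> X \<union> Y. e \<subseteq> V}" "Y = {e \<in> X \<union> Y. e \<subseteq> W}"
    if "tree_edges V X" "tree_edges W Y" for X Y
    using tree_edges_subset[OF that(1)] tree_edges_subset[OF that(2)] assms(3) by blast+
  have eq: "snd g \<union> snd h = E \<union> F \<longleftrightarrow> g = (V, E) \<and> h = (W, F)"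
    if "g \<in> Poly_Mapping.keys ?x" "h \<in> Poly_Mapping.keys ?y" for g h
  proof -
    have "fst g = V" "fst h = W" and "tree_edges V (snd g)" "tree_edges W (snd h)"
      using that keys by (auto simp: spanning_trees_def)
    then show ?thesis using split[of "snd g" "snd h"] split[OF assms(4,5)] by (metis prod.collapse snd_conv)
  qed
  have "Poly_Mapping.lookup (cut_graphs (Node (Upair s t)) :: _ \<Rightarrow>\<^sub>0 'k) (E \<union> F) =
    (\<Sum>g\<in>Poly_Mapping.keys ?x. \<Sum>h\<in>Poly_Mapping.keys ?y. if g = (V, E) then
      (if h = (W, F) then Poly_Mapping.lookup ?x g * Poly_Mapping.lookup ?y h else 0) else 0)"
    unfolding cut_graphs_Node lookup_bilinear_ext
    by (intro sum.cong refl) (simp add: lookup_single when_def eq)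
  also have "\<dots> = (\<Sum>g\<in>Poly_Mapping.keys ?x. if g = (V, E) then (\<Sum>h\<in>Poly_Mapping.keys ?y.
      (if h = (W, F) then Poly_Mapping.lookup ?x g * Poly_Mapping.lookup ?y h else 0)) else 0)"
    by (intro sum.cong refl) simp
  also have "\<dots> = Poly_Mapping.lookup ?x (V, E) * Poly_Mapping.lookup ?y (W, F)"
    by (simp add: in_keys_iff)
  finally show ?thesis .
qed

text \<open>If the edges came from trees on \<open>W1\<close> and \<open>W2\<close>, none would
  cross this cut. As \<open>V1\<close> and \<open>V2\<close> are connected, each would lie inside
  \<open>W1\<close> or avoid it, which forces \<open>W1\<close> to be one of them.\<close>

lemma lookup_cut_graphs_other:
  assumes "is_tree_on W1 s" "is_tree_on W2 t" "W1 \<inter> W2 = {}" "tree_edges V1 E" "tree_edges V2 F"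
    "V1 \<inter> V2 = {}" "V1 \<union> V2 = W1 \<union> W2" "W1 \<noteq> V1" "W1 \<noteq> V2"
  shows "Poly_Mapping.lookup (cut_graphs (Node (Upair s t)) :: _ \<Rightarrow>\<^sub>0 'k::field) (E \<union> F) = 0"
proof -
  let ?x = "tree_graphs s :: _ \<Rightarrow>\<^sub>0 'k" and ?y = "tree_graphs t :: _ \<Rightarrow>\<^sub>0 'k"
  have keys: "Poly_Mapping.keys ?x \<subseteq> spanning_trees W1" "Poly_Mapping.keys ?y \<subseteq> spanning_trees W2"
    using tree_graphs_mem[OF assms(1)] tree_graphs_mem[OF assms(2)] by (auto simp: free_space_def)
  have "snd g \<union> snd h \<noteq> E \<union> F"
    if "g \<in> Poly_Mapping.keys ?x" "h \<in> Poly_Mapping.keys ?y" for g h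
  proof
    assume eq: "snd g \<union> snd h = E \<union> F"
    have tr: "tree_edges W1 (snd g)" "tree_edges W2 (snd h)"
      using that keys by (auto simp: spanning_trees_def)
    have side: "e \<subseteq> W1 \<or> e \<subseteq> W2" if "e \<in> E \<union> F" for e
      using tree_edges_subset[OF tr(1)] tree_edges_subset[OF tr(2)] that eq by blast
    have "V \<subseteq> W1 \<or> V \<inter> W1 = {}" if V: "tree_edges V X" "X \<subseteq> E \<union> F" for V X
    proof (rule ccontr)
      assume "\<not> (V \<subseteq> W1 \<or> V \<inter> W1 = {})"
      then obtain e where "e \<in> X" "e \<inter> W1 \<noteq> {}" "e - W1 \<noteq> {}"
        using tree_edges_crossing[OF V(1), of W1] by blast
      then show False using side[of e] V(2) assms(3) by blast
    qed
    from this[OF assms(4)] this[OF assms(5)]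
    have "V1 \<subseteq> W1 \<or> V1 \<inter> W1 = {}" "V2 \<subseteq> W1 \<or> V2 \<inter> W1 = {}" by auto
    moreover have "W1 \<noteq> {}" "W2 \<noteq> {}" using tr tree_edges_finite by blast+
    ultimately show False using assms(3,6-9) by blast
  qed
  then show ?thesis
    unfolding cut_graphs_Node lookup_bilinear_ext
    by (intro sum.neutral ballI) (simp add: lookup_single when_def)
qed

text \<open>Linear independence of the images of all trees on \<open>V\<close>. The induction is on
  \<open>V\<close> for arbitrary coefficients, because the relations on the two leaf sets below the
  root have new ones.\<close>

lemma tree_graphs_independent:
  fixes c :: "'v ctree \<Rightarrow> 'k::field_char_0"
  assumes "finite V"
    and "\<And>E. (\<Sum>t | is_tree_on V t. c t * Poly_Mapping.lookup (tree_graphs t) (V, E)) = 0"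
    and "is_tree_on V t"
  shows "c t = 0"
  using assms
proof (induction V arbitrary: c t rule: finite_psubset_induct)
  case (psubset V)
  from psubset.prems(2) show ?case
  proof (cases rule: is_tree_on.cases)
    case (Leaf v)
    then have "{t. is_tree_on V t} = {Leaf v}"
      using is_tree_on_singletonD is_tree_on.Leaf by auto
    \<comment> \<open>The graph without edges has coefficient 1 in the image of the only
      tree.\<close>
    then show ?thesis using psubset.prems(1)[of "{}"] Leaf by simp
  next
    case (Node V1 s1 V2 s2)
    let ?T = "\<lambda>W. {t. is_tree_on W t}"
    let ?g = "\<lambda>t W E. Poly_Mapping.lookup (tree_graphs t) (W, E) :: 'k"
    let ?N = "\<lambda>(s, t). Node (Upair s t)"
    have ne: "V1 \<noteq> {}" "V2 \<noteq> {}"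
      using is_tree_on_nonempty Node by blast+
    then have sub: "V1 \<subset> V" "V2 \<subset> V" using Node by auto
    have nodes: "\<exists>W1 W2 r1 r2. t = Node (Upair r1 r2) \<and> V = W1 \<union> W2 \<and> W1 \<inter> W2 = {} \<and>
        is_tree_on W1 r1 \<and> is_tree_on W2 r2" if t: "is_tree_on V t" for t
    proof -
      obtain v where "v \<in> V" "V \<noteq> {v}" using ne Node by blast
      then show ?thesis using is_tree_on_NodeE[OF t] by metis
    qed
    \<comment> \<open>The cut coefficients of the whole relation. Their sum over the edges of a
      spanning tree gives back the assumed relation, hence 0.\<close>
    define A where "A F = (\<Sum>t\<in>?T V. c t * Poly_Mapping.lookup (cut_graphs t) F)" for F
    have "(\<Sum>e\<in>E. A (E - {e})) = 0" if E: "tree_edges V E" for E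
    proof -
      have "(\<Sum>e\<in>E. A (E - {e})) =
          (\<Sum>t\<in>?T V. c t * (\<Sum>e\<in>E. Poly_Mapping.lookup (cut_graphs t) (E - {e})))"
        unfolding A_def sum_distrib_left by (rule sum.swap)
      also have "\<dots> = (\<Sum>t\<in>?T V. c t * ?g t V E)"
      proof (intro sum.cong refl)
        fix t assume "t \<in> ?T V"
        then obtain W1 W2 r1 r2 where "t = Node (Upair r1 r2)" "V = W1 \<union> W2" "W1 \<inter> W2 = {}"
          "is_tree_on W1 r1" "is_tree_on W2 r2" using nodes[of t] by blast
        then show "c t * (\<Sum>e\<in>E. Poly_Mapping.lookup (cut_graphs t) (E - {e})) = c t * ?g t V E"
          using lookup_tree_graphs_eq_sum[of W1 r1 W2 r2 E, where 'k = 'k] E by simp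
      qed
      finally show ?thesis using psubset.prems(1) by simp
    qed
    then have A0: "A F = 0" if "forest2_edges V F" for F
      using forest2_function_eq_0[OF psubset.hyps(1), of A F] that by blast
    \<comment> \<open>Although a node is unordered, the disjoint nonempty leaf sets
      \<open>V1\<close> and \<open>V2\<close> tell its two subtrees apart.\<close>
    have inj: "inj_on ?N (?T V1 \<times> ?T V2)"
    proof (rule inj_onI)
      fix p q assume p: "p \<in> ?T V1 \<times> ?T V2" and q: "q \<in> ?T V1 \<times> ?T V2" and eq: "?N p = ?N q"
      have "fst p \<noteq> snd q" using is_tree_on_unique[of V1 "fst p" V2] p q Node ne by auto
      then show "p = q" using eq by (auto simp: split_beta prod_eq_iff)
    qed
    have zero: "(\<Sum>r\<in>?T V1. \<Sum>q\<in>?T V2. c (?N (r, q)) * ?g r V1 E * ?g q V2 F) = 0" for E F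
    proof (cases "tree_edges V1 E \<and> tree_edges V2 F")
      case True
      have "0 = A (E \<union> F)" using A0[of "E \<union> F"] tree_edges_Un_forest2[of V1 E V2 F] True Node by simp
      also have "\<dots> = (\<Sum>t\<in>?N ` (?T V1 \<times> ?T V2). c t * Poly_Mapping.lookup (cut_graphs t) (E \<union> F))"
        unfolding A_def
      proof (rule sum.mono_neutral_right)
        show "finite (?T V)" using psubset.hyps(1) by (rule finite_trees)
        show "?N ` (?T V1 \<times> ?T V2) \<subseteq> ?T V" using Node by (auto intro: is_tree_on.Node)
        \<comment> \<open>Trees whose root splits the leaves differently have coefficient 0 at a
          forest with components \<open>V1\<close> and \<open>V2\<close>.\<close>
        show "\<forall>t\<in>?T V - ?N ` (?T V1 \<times> ?T V2). c t * Poly_Mapping.lookup (cut_graphs t) (E \<union> F) = 0"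
        proof
          fix t assume t: "t \<in> ?T V - ?N ` (?T V1 \<times> ?T V2)"
          then obtain W1 W2 r1 r2 where W: "t = Node (Upair r1 r2)" "V = W1 \<union> W2" "W1 \<inter> W2 = {}"
            "is_tree_on W1 r1" "is_tree_on W2 r2" using nodes[of t] by blast
          have "W1 \<noteq> V1"
          proof
            assume "W1 = V1"
            then have "W2 = V2" using W Node by blast
            then have "t = ?N (r1, r2)" "(r1, r2) \<in> ?T V1 \<times> ?T V2" using W \<open>W1 = V1\<close> by auto
            then show False using t by blast
          qed
          moreover have "W1 \<noteq> V2"
          proof
            assume "W1 = V2"
            then have "W2 = V1" using W Node by blast
            then have "t = ?N (r2, r1)" "(r2, r1) \<in> ?T V1 \<times> ?T V2" using W \<open>W1 = V2\<close> by auto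
            then show False using t by blast
          qed
          ultimately have "Poly_Mapping.lookup (cut_graphs t :: _ \<Rightarrow>\<^sub>0 'k) (E \<union> F) = 0"
            unfolding W(1) using W Node True by (intro lookup_cut_graphs_other[of W1 _ W2 _ V1 _ V2]) auto
          then show "c t * Poly_Mapping.lookup (cut_graphs t) (E \<union> F) = 0" by simp
        qed
      qed
      also have "\<dots> = (\<Sum>p\<in>?T V1 \<times> ?T V2. c (?N p) * Poly_Mapping.lookup (cut_graphs (?N p)) (E \<union> F))"
        by (subst sum.reindex[OF inj]) simp
      also have "\<dots> = (\<Sum>(r, q)\<in>?T V1 \<times> ?T V2. c (?N (r, q)) * ?g r V1 E * ?g q V2 F)"
        using Node True by (intro sum.cong refl) (auto simp: lookup_cut_graphs[of V1 _ V2])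
      finally show ?thesis by (simp add: sum.cartesian_product)
    next
      case False
      then show ?thesis
        by (intro sum.neutral ballI) (auto simp: lookup_tree_graphs_eq_0)
    qed
    \<comment> \<open>For fixed \<open>F\<close> these sums are the coefficients of a relation
      between trees on \<open>V1\<close>, so they vanish. Each of them is then a relation between
      trees on \<open>V2\<close>.\<close>
    have "(\<Sum>q\<in>?T V2. c (?N (r, q)) * ?g q V2 F) = 0" if "is_tree_on V1 r" for r F
    proof (rule psubset.IH[OF sub(1) _ that])
      fix E
      show "(\<Sum>r\<in>?T V1. (\<Sum>q\<in>?T V2. c (?N (r, q)) * ?g q V2 F) * ?g r V1 E) = 0"
        using zero[of E F] by (simp add: sum_distrib_left mult_ac)
    qed
    from psubset.IH[OF sub(2) this[OF Node(3)] Node(4)]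
    show ?thesis using Node by simp
  qed
qed


section \<open>The morphism from \<open>ComMag\<close> onto \<open>Seg\<close>\<close>

lemma linear_on_zero:
  assumes "linear_species P" "linear_species Q" "finite V"
    and "linear_on (spc P V) (smul P) (smul Q) f"
  shows "f 0 = 0"
proof -
  interpret P: linear_species P by fact
  interpret Q: linear_species Q by fact
  interpret VP: vector_space "smul P" by (rule P.vector_space)
  interpret VQ: vector_space "smul Q" by (rule Q.vector_space)
  have "0 \<in> spc P V" using VP.subspace_0 P.subspace assms(3) by blast
  then have "f (smul P 0 0) = smul Q 0 (f 0)" using assms(4) unfolding linear_on_def by blast
  then show ?thesis by simp
qed

lemma suboperad_transport:
  "\<lbrakk>suboperad P S; finite V; inj_on \<sigma> V; x \<in> S V\<rbrakk> \<Longrightarrow> transport P V \<sigma> x \<in> S (\<sigma> ` V)"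
  by (simp add: suboperad_def)

lemma suboperad_pcomp:
  "\<lbrakk>suboperad P S; composable V1 a V2; x \<in> S (insert a V1); y \<in> S V2\<rbrakk> \<Longrightarrow>
    pcomp P V1 a V2 x y \<in> S (V1 \<union> V2)"
  by (simp add: suboperad_def)

lemma suboperad_image:
  assumes "operad P" "operad Q" and hom: "operad_hom P Q \<phi>"
    and S: "\<And>V. finite V \<Longrightarrow> S V = \<phi> V ` spc P V"
  shows "suboperad Q S"
proof -
  interpret P: operad P by fact
  interpret Q: operad Q by fact
  interpret VP: vector_space "smul P" by (rule P.vector_space)
  interpret VQ: vector_space "smul Q" by (rule Q.vector_space)
  have "VQ.subspace (\<phi> V ` spc P V)" if V: "finite V" for V
  proof -
    have lin: "linear_on (spc P V) (smul P) (smul Q) (\<phi> V)" using hom V by (simp add: operad_hom_def)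
    have sub: "VP.subspace (spc P V)" using P.subspace V by blast
    have "\<phi> V 0 = 0"
      using linear_on_zero[OF P.linear_species_axioms Q.linear_species_axioms V lin] .
    then have "0 \<in> \<phi> V ` spc P V" using VP.subspace_0[OF sub] by force
    moreover have "\<phi> V x + \<phi> V y \<in> \<phi> V ` spc P V" if "x \<in> spc P V" "y \<in> spc P V" for x y
      using lin that VP.subspace_add[OF sub that] unfolding linear_on_def by (metis imageI)
    moreover have "smul Q c (\<phi> V x) \<in> \<phi> V ` spc P V" if "x \<in> spc P V" for c x
      using lin that VP.subspace_scale[OF sub that] unfolding linear_on_def by (metis imageI)
    ultimately show ?thesis unfolding VQ.subspace_def by blast
  qed
  moreover have "transport Q V \<sigma> (\<phi> V x) \<in> \<phi> (\<sigma> ` V) ` spc P (\<sigma> ` V)"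
    if "finite V" "inj_on \<sigma> V" "x \<in> spc P V" for V \<sigma> x
    using hom that P.transport_mem[OF that] unfolding operad_hom_def by (metis imageI)
  moreover have "ounit Q v \<in> \<phi> {v} ` spc P {v}" for v
    using hom P.unit_mem[of v] unfolding operad_hom_def by (metis imageI)
  moreover have "pcomp Q V1 a V2 (\<phi> (insert a V1) x) (\<phi> V2 y) \<in> \<phi> (V1 \<union> V2) ` spc P (V1 \<union> V2)"
    if "composable V1 a V2" "x \<in> spc P (insert a V1)" "y \<in> spc P V2" for V1 a V2 x y
    using hom that P.comp_mem[OF that] unfolding operad_hom_def by (metis imageI)
  moreover have "\<phi> V ` spc P V \<subseteq> spc Q V" if "finite V" for V
    using hom that by (simp add: operad_hom_def)
  ultimately show ?thesis
    unfolding suboperad_def by (auto simp: S composable_def)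
qed

text \<open>\<open>operad_isomorphic\<close> demands that both sides are operads. All axioms
  restrict because \<open>S V\<close> is contained in \<open>spc P V\<close> for finite
  \<open>V\<close>.\<close>

lemma operad_suboperad:
  fixes P :: "('v, 'k::field, 'm::ab_group_add) operad"
  assumes "operad P" "suboperad P S"
  shows "operad (P\<lparr>spc := S\<rparr>)"
proof -
  interpret operad P by fact
  interpret VS: vector_space "smul P" by (rule vector_space)
  have sub: "S V \<subseteq> spc P V" "VS.subspace (S V)" if "finite V" for V
    using assms(2) that by (auto simp: suboperad_def)
  have mem: "x \<in> spc P V" if "finite V" "x \<in> S V" for V x using sub that by blast
  have comp: "composable V1 a V2 \<Longrightarrow> finite V1 \<and> finite V2" for V1 a V2 by (simp add: composable_def)
  show ?thesis
  proof (rule operad.intro[OF linear_species.intro operad_axioms.intro], goal_cases)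
    case 1 show ?case by (simp add: vector_space)
  next
    case 2 then show ?case by (simp add: sub)
  next
    case 3 then show ?case using assms(2) by (simp add: suboperad_def)
  next
    case (4 V \<sigma>) then show ?case using transport_linear[OF 4] mem by (simp add: linear_on_def)
  next
    case (5 V \<sigma> \<tau> x) then show ?case using transport_cong[OF 5(1-3)] mem by simp
  next
    case 6 then show ?case using mem by (simp add: transport_id)
  next
    case 7 then show ?case using mem by (simp add: transport_comp)
  next
    case 8
    have "S {} \<subseteq> {0}" using sub(1)[of "{}"] spc_empty by simp
    moreover have "0 \<in> S {}" using sub(2)[of "{}"] VS.subspace_0 by blast
    ultimately show ?case by auto
  next
    case 9 show ?case using assms(2) by (simp add: suboperad_def)
  next
    case 10 show ?case by (simp add: unit_natural)
  next
    case 11 then show ?case using assms(2) by (simp add: suboperad_def)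
  next
    case (12 V1 a V2 y)
    then show ?case using comp_linear_left[OF 12(1), of y] comp[OF 12(1)] mem by (simp add: linear_on_def)
  next
    case (13 V1 a V2 x)
    then show ?case using comp_linear_right[OF 13(1), of x] comp[OF 13(1)] mem by (simp add: linear_on_def)
  next
    case (14 V1 a V2 x y \<sigma> \<tau> \<rho>)
    then show ?case using comp[OF 14(1)] mem by (simp add: comp_natural)
  next
    case 15 then show ?case using mem by (simp add: comp_sequential)
  next
    case (16 V1 V2 V3 a b x y z)
    then show ?case using comp_parallel[OF 16(1-11), of x y z] mem by simp
  next
    case 17 then show ?case using mem by (simp add: comp_unit_right)
  next
    case 18 then show ?case using mem by (simp add: comp_unit_left)
  qed
qed

text \<open>\<open>S\<close> is prescribed on finite sets only, the only ones on which the image is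
  going to be compared with \<open>Seg\<close>.\<close>

lemma operad_isomorphic_image:
  assumes "operad P" "operad Q" and hom: "operad_hom P Q \<phi>"
    and inj: "\<And>V. finite V \<Longrightarrow> inj_on (\<phi> V) (spc P V)"
    and S: "\<And>V. finite V \<Longrightarrow> S V = \<phi> V ` spc P V"
  shows "operad_isomorphic (Q\<lparr>spc := S\<rparr>) P"
proof -
  interpret P: operad P by fact
  interpret VP: vector_space "smul P" by (rule P.vector_space)
  \<comment> \<open>The isomorphism leads from the image back to \<open>P\<close>, so its components
    are the inverses of those of the morphism.\<close>
  define \<psi> where "\<psi> V = inv_into (spc P V) (\<phi> V)" for V
  have inv: "\<psi> V (\<phi> V x) = x" if "finite V" "x \<in> spc P V" for V x
    unfolding \<psi>_def using inj that by simp
  have bij: "bij_betw (\<psi> V) (S V) (spc P V)" if "finite V" for V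
    unfolding \<psi>_def S[OF that] by (rule bij_betw_inv_into) (use inj[OF that] in \<open>simp add: bij_betw_def\<close>)
  have lin: "linear_on (S V) (smul Q) (smul P) (\<psi> V)" if V: "finite V" for V
  proof -
    have lin: "linear_on (spc P V) (smul P) (smul Q) (\<phi> V)" using hom V by (simp add: operad_hom_def)
    have sub: "VP.subspace (spc P V)" using P.subspace V by blast
    have "\<psi> V (\<phi> V x + \<phi> V y) = x + y" if "x \<in> spc P V" "y \<in> spc P V" for x y
      using lin that inv[OF V VP.subspace_add[OF sub that]] unfolding linear_on_def by simp
    moreover have "\<psi> V (smul Q c (\<phi> V x)) = smul P c x" if "x \<in> spc P V" for c x
      using lin that inv[OF V VP.subspace_scale[OF sub that]] unfolding linear_on_def by simp
    ultimately show ?thesis by (auto simp: linear_on_def S[OF V] inv[OF V])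
  qed
  have tr: "\<psi> (\<sigma> ` V) (transport Q V \<sigma> (\<phi> V x)) = transport P V \<sigma> x"
    if "finite V" "inj_on \<sigma> V" "x \<in> spc P V" for V \<sigma> x
    using hom that inv[OF finite_imageI[OF that(1)] P.transport_mem[OF that]] unfolding operad_hom_def by metis
  have un: "\<psi> {v} (ounit Q v) = ounit P v" for v
    using hom inv[OF _ P.unit_mem[of v]] unfolding operad_hom_def by (metis finite.emptyI finite_insert)
  have co: "\<psi> (V1 \<union> V2) (pcomp Q V1 a V2 (\<phi> (insert a V1) x) (\<phi> V2 y)) = pcomp P V1 a V2 x y"
    if "composable V1 a V2" "x \<in> spc P (insert a V1)" "y \<in> spc P V2" for V1 a V2 x y
  proof -
    have "finite (V1 \<union> V2)" using that by (simp add: composable_def)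
    then show ?thesis using hom that inv[OF _ P.comp_mem[OF that]] unfolding operad_hom_def by metis
  qed
  have "operad_hom (Q\<lparr>spc := S\<rparr>) P \<psi>"
    unfolding operad_hom_def
  proof (intro conjI allI impI ballI, goal_cases)
    case (1 V) then show ?case using bij by (simp add: bij_betw_def)
  next
    case (2 V) then show ?case using lin by simp
  next
    case (3 V \<sigma> x)
    then obtain x' where "x' \<in> spc P V" "x = \<phi> V x'" by (auto simp: S)
    then show ?case using 3 by (simp add: tr inv)
  next
    case 4 show ?case by (simp add: un)
  next
    case (5 V1 a V2 x y)
    then have fin: "finite V1" "finite V2" by (simp_all add: composable_def)
    then obtain x' y' where "x' \<in> spc P (insert a V1)" "x = \<phi> (insert a V1) x'"
      "y' \<in> spc P V2" "y = \<phi> V2 y'" using 5 by (auto simp: S)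
    then show ?case using 5 fin by (simp add: co inv)
  qed
  moreover have "operad (Q\<lparr>spc := S\<rparr>)"
    by (rule operad_suboperad[OF assms(2) suboperad_image[OF assms(1-3) S]])
  ultimately show ?thesis unfolding operad_isomorphic_def using assms(1) bij by auto
qed

section \<open>The map on trees is a morphism of operads\<close>

lemma bilinear_ext_lin_ext:
  "bilinear_ext f (lin_ext A x) (lin_ext B y) = bilinear_ext (\<lambda>g h. bilinear_ext f (A g) (B h)) x y"
  unfolding bilinear_ext_def lin_ext_lin_ext
  by (intro lin_ext_cong) (rule lin_ext_swap)

lemma lin_ext_bilinear_ext:
  "lin_ext F (bilinear_ext f x y) = bilinear_ext (\<lambda>g h. lin_ext F (f g h)) x y"
  unfolding bilinear_ext_def lin_ext_lin_ext ..

lemma Graph_operad_sel [simp]: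
  "smul Graph_operad = pm_scale"
  "spc Graph_operad V = free_space (simple_graphs V)"
  "transport Graph_operad V \<sigma> = lin_ext (\<lambda>g. Poly_Mapping.single (\<sigma> ` fst g, (`) \<sigma> ` snd g) 1)"
  "ounit Graph_operad v = Poly_Mapping.single ({v}, {}) 1"
  "pcomp Graph_operad V1 a V2 x y = bilinear_ext (graph_comp V1 a V2) x y"
  by (simp_all add: Graph_operad_def basis_operad_def bilinear_ext_def split_beta)

lemma ComMag_sel [simp]:
  "smul ComMag = pm_scale"
  "spc ComMag V = free_space {t. is_tree_on V t}"
  "transport ComMag V \<sigma> = lin_ext (\<lambda>t. Poly_Mapping.single (map_ctree \<sigma> t) 1)"
  "ounit ComMag v = Poly_Mapping.single (Leaf v) 1"
  "pcomp ComMag V1 a V2 x y = bilinear_ext (\<lambda>s t. Poly_Mapping.single (graft a t s) 1) x y"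
  by (simp_all add: ComMag_def basis_operad_def bilinear_ext_def)

lemma spanning_trees_subset: "spanning_trees V \<subseteq> simple_graphs V"
proof -
  have "\<exists>u v. e = {u, v} \<and> u \<in> V \<and> v \<in> V \<and> u \<noteq> v" if "tree_edges V E" "e \<in> E" for V e and E :: "'a set set"
    using that by (induction rule: tree_edges.induct) blast+
  then show ?thesis using tree_edges_finite by (fastforce simp: spanning_trees_def simple_graphs_iff)
qed

lemma tree_graphs_simple: "is_tree_on V t \<Longrightarrow> (tree_graphs t :: _ \<Rightarrow>\<^sub>0 'k::field) \<in> free_space (simple_graphs V)"
  using tree_graphs_mem[of V t] spanning_trees_subset unfolding free_space_def by blast

lemma segment_mem: "p \<noteq> q \<Longrightarrow> (segment p q :: _ \<Rightarrow>\<^sub>0 'k::field) \<in> free_space (simple_graphs {p, q})"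
  by (auto simp: segment_def simple_graphs_iff)

text \<open>Covers compositions at a vertex with a single neighbour: choosing a function there means
  choosing one vertex.\<close>

lemma sum_PiE_singleton: "(\<Sum>f\<in>{q} \<rightarrow>\<^sub>E V. F f) = (\<Sum>u\<in>V. F (\<lambda>v\<in>{q}. u))"
  by (rule sum.reindex_bij_witness[where i = "\<lambda>u. \<lambda>v\<in>{q}. u" and j = "\<lambda>f. f q"])
    (auto simp: PiE_def extensional_def restrict_def fun_eq_iff intro!: arg_cong[of _ _ F])

lemma lin_ext_fun_sum: "lin_ext (\<lambda>h. \<Sum>u\<in>U. f u h) y = (\<Sum>u\<in>U. lin_ext (f u) y)"
proof (rule poly_mapping_eqI)
  fix k
  show "Poly_Mapping.lookup (lin_ext (\<lambda>h. \<Sum>u\<in>U. f u h) y) k = Poly_Mapping.lookup (\<Sum>u\<in>U. lin_ext (f u) y) k"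
    by (simp add: lookup_lin_ext lookup_sum sum_distrib_left sum.swap[of _ U])
qed

text \<open>The second end of the segment carries a label \<open>q\<close> from \<open>W\<close>.
  This is legitimate, as the composition at \<open>q\<close> removes this vertex before
  \<open>W\<close> is inserted, and so no fresh label is required.\<close>

lemma pcomp_segment:
  fixes x y :: "'v sgraph \<Rightarrow>\<^sub>0 'k::field"
  assumes x: "x \<in> free_space (simple_graphs V)" and y: "y \<in> free_space (simple_graphs W)"
    and "V \<inter> W = {}" "q \<in> W" "p \<noteq> q"
  shows "pcomp Graph_operad V q W (pcomp Graph_operad {q} p V (segment p q) x) y = bilinear_ext join x y"
proof -
  have q: "q \<notin> V" using assms by auto
  \<comment> \<open>After inserting \<open>g\<close> at \<open>p\<close>, the vertex
    \<open>q\<close> hangs as a leaf on some \<open>u\<close> in \<open>V\<close>.\<close>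
  have first: "graph_comp {q} p V ({p, q}, {{p, q}}) g =
      (\<Sum>u\<in>V. Poly_Mapping.single (insert q V, insert {q, u} (snd g)) (1::'k))"
    if g: "g \<in> simple_graphs V" for g
  proof -
    have "neighbours ({p, q}, {{p, q}}) p = {q}"
      using assms(5) by (auto simp: neighbours_def doubleton_eq_iff)
    moreover have "graph_insert {q} p ({p, q}, {{p, q}}) g (\<lambda>v\<in>{q}. u) = (insert q V, insert {q, u} (snd g))" for u
      unfolding graph_insert_alt calculation using fst_simple[OF g] assms(5) by auto
    ultimately show ?thesis unfolding graph_comp_def by (simp add: sum_PiE_singleton)
  qed
  \<comment> \<open>The only neighbour of \<open>q\<close> is \<open>u\<close>, so inserting
    \<open>h\<close> at \<open>q\<close> connects \<open>u\<close> to each vertex of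
    \<open>W\<close> in turn.\<close>
  have second: "graph_comp V q W (insert q V, insert {q, u} (snd g)) h =
      (\<Sum>v\<in>W. Poly_Mapping.single (V \<union> W, insert {u, v} (snd g \<union> snd h)) (1::'k))"
    if g: "g \<in> simple_graphs V" and h: "h \<in> simple_graphs W" and u: "u \<in> V" for g h u
  proof -
    have gV: "e \<subseteq> V" if "e \<in> snd g" for e using edgeD[OF g that] by auto
    have n: "neighbours (insert q V, insert {q, u} (snd g)) q = {u}"
      using gV q by (auto simp: neighbours_def doubleton_eq_iff)
    have "{e \<in> insert {q, u} (snd g). e \<subseteq> V} = snd g" using gV q by auto
    then have "graph_insert V q (insert q V, insert {q, u} (snd g)) h (\<lambda>w\<in>{u}. v) =
        (V \<union> W, insert {u, v} (snd g \<union> snd h))" for v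
      unfolding graph_insert_alt n using fst_simple[OF h] by auto
    then show ?thesis unfolding graph_comp_def n by (simp add: sum_PiE_singleton)
  qed
  have "pcomp Graph_operad V q W (pcomp Graph_operad {q} p V (segment p q) x) y =
      lin_ext (\<lambda>g. lin_ext (\<lambda>k. lin_ext (graph_comp V q W k) y) (graph_comp {q} p V ({p, q}, {{p, q}}) g)) x"
    by (simp add: segment_def bilinear_ext_def lin_ext_lin_ext)
  also have "\<dots> = bilinear_ext join x y"
    unfolding bilinear_ext_def
  proof (rule lin_ext_cong'[OF x])
    fix g assume g: "g \<in> simple_graphs V"
    have "lin_ext (\<lambda>k. lin_ext (graph_comp V q W k) y) (graph_comp {q} p V ({p, q}, {{p, q}}) g) =
        lin_ext (\<lambda>h. \<Sum>u\<in>V. graph_comp V q W (insert q V, insert {q, u} (snd g)) h) y"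
      unfolding first[OF g] lin_ext_sum lin_ext_single lin_ext_fun_sum ..
    also have "\<dots> = lin_ext (join g) y"
    proof (rule lin_ext_cong'[OF y])
      fix h assume h: "h \<in> simple_graphs W"
      show "(\<Sum>u\<in>V. graph_comp V q W (insert q V, insert {q, u} (snd g)) h) = (join g h :: _ \<Rightarrow>\<^sub>0 'k)"
        by (simp add: second[OF g h] join_def fst_simple[OF g] fst_simple[OF h] sum.cartesian_product)
    qed
    finally show "lin_ext (\<lambda>k. lin_ext (graph_comp V q W k) y) (graph_comp {q} p V ({p, q}, {{p, q}}) g) =
        lin_ext (join g) y" .
  qed
  finally show ?thesis .
qed

text \<open>With nodes expressed as compositions of the segment, compatibility with grafting follows
  from the operad axioms.\<close>

lemma tree_graphs_Node_eq_pcomp: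
  assumes "is_tree_on V s" "is_tree_on W t" "V \<inter> W = {}" "q \<in> W" "p \<noteq> q"
  shows "tree_graphs (Node (Upair s t)) =
    pcomp Graph_operad V q W (pcomp Graph_operad {q} p V (segment p q) (tree_graphs s)) (tree_graphs t)"
  unfolding tree_graphs_Node
  by (rule pcomp_segment[symmetric]) (use assms tree_graphs_simple in auto)

text \<open>Grafting below the root commutes with forming the node: sequential associativity pulls
  the graft out of the first insertion into the segment, and parallel associativity exchanges it
  with the second insertion.\<close>

lemma tree_graphs_graft_Node:
  assumes s: "is_tree_on V s" and r: "is_tree_on W r" and t: "is_tree_on U t"
    and disj: "V \<inter> W = {}" "a \<in> V" "(V \<union> W - {a}) \<inter> U = {}"
    and IH: "tree_graphs (graft a t s) =
      (pcomp Graph_operad (V - {a}) a U (tree_graphs s) (tree_graphs t) :: _ \<Rightarrow>\<^sub>0 'k::field)"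
  shows "tree_graphs (graft a t (Node (Upair s r))) =
    (pcomp Graph_operad (V \<union> W - {a}) a U (tree_graphs (Node (Upair s r))) (tree_graphs t) :: _ \<Rightarrow>\<^sub>0 'k)"
proof -
  interpret G: operad "Graph_operad :: (_, 'k, _) operad" by (rule operad_Graph_operad)
  let ?c = "pcomp (Graph_operad :: (_, 'k, _) operad)"
  let ?V = "V - {a}"
  obtain q where q: "q \<in> W" using is_tree_on_nonempty[OF r] by blast
  have fin: "finite ?V" "finite U" "finite W"
    using is_tree_on_nonempty[OF s] is_tree_on_nonempty[OF t] is_tree_on_nonempty[OF r] by auto
  have d: "?V \<inter> U = {}" "?V \<inter> W = {}" "U \<inter> W = {}" "a \<noteq> q" "a \<notin> W" "q \<notin> ?V" "q \<notin> U"
    "q \<notin> V" "insert a ?V = V" "V \<union> W - {a} = ?V \<union> W" using disj q by auto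
  note mem = tree_graphs_simple[OF s, where 'k = 'k] tree_graphs_simple[OF t, where 'k = 'k] tree_graphs_simple[OF r, where 'k = 'k] segment_mem[OF d(4), where 'k = 'k]
  \<comment> \<open>The first end of the segment only has to differ from \<open>q\<close>, and the
    grafting leaf \<open>a\<close> does.\<close>
  let ?x = "?c {q} a V (segment a q) (tree_graphs s)"
  have qV: "insert a (insert q ?V) = {q} \<union> V" using disj(2) by auto
  have x: "?x \<in> spc Graph_operad (insert a (insert q ?V))"
    unfolding qV using mem d fin is_tree_on_nonempty[OF s] by (intro G.comp_mem) (auto simp: composable_def)
  have "tree_graphs (graft a t (Node (Upair s r))) = (tree_graphs (Node (Upair (graft a t s) r)) :: _ \<Rightarrow>\<^sub>0 'k)"
    using graft_notin[of a r t] is_tree_on_set[OF r] d(5) by simp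
  also have "\<dots> = ?c (?V \<union> U) q W (?c {q} a (?V \<union> U) (segment a q) (tree_graphs (graft a t s))) (tree_graphs r)"
    using is_tree_graft[OF t s disj(2) d(1)] r d q by (intro tree_graphs_Node_eq_pcomp) auto
  also have "?c {q} a (?V \<union> U) (segment a q) (tree_graphs (graft a t s)) = ?c ({q} \<union> ?V) a U ?x (tree_graphs t)"
    \<comment> \<open>Here \<open>a\<close> is both the end of the segment that is replaced and the
      leaf of \<open>s\<close> that is grafted onto.\<close>
    unfolding IH using G.comp_sequential[of "{q}" ?V U a a "segment a q" "tree_graphs s" "tree_graphs t"] mem d fin
    by simp
  also have "?c (?V \<union> U) q W (?c ({q} \<union> ?V) a U ?x (tree_graphs t)) (tree_graphs r) =
      ?c (?V \<union> W) a U (?c (insert a ?V) q W ?x (tree_graphs r)) (tree_graphs t)"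
    using G.comp_parallel[of ?V U W a q ?x "tree_graphs t" "tree_graphs r"] mem d fin x by simp
  also have "?c (insert a ?V) q W ?x (tree_graphs r) = tree_graphs (Node (Upair s r))"
    unfolding d(9) using s r disj q d by (intro tree_graphs_Node_eq_pcomp[symmetric]) auto
  finally show ?thesis unfolding d(10) .
qed

lemma tree_graphs_graft:
  assumes "is_tree_on X s" "is_tree_on U t" "a \<in> X" "(X - {a}) \<inter> U = {}"
  shows "tree_graphs (graft a t s) =
    (pcomp Graph_operad (X - {a}) a U (tree_graphs s) (tree_graphs t) :: _ \<Rightarrow>\<^sub>0 'k::field)"
  using assms(1,3,4)
proof (induction rule: is_tree_on.induct)
  case (Leaf v)
  have "finite U" using is_tree_on_nonempty[OF assms(2)] by blast
  then show ?case
    using Leaf operad.comp_unit_left[OF operad_Graph_operad, of U "tree_graphs t :: _ \<Rightarrow>\<^sub>0 'k" a]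
      tree_graphs_simple[OF assms(2), where 'k = 'k] by simp
next
  case (Node V s W r)
  show ?case
  proof (cases "a \<in> V")
    case True
    then show ?thesis using Node by (intro tree_graphs_graft_Node[OF _ _ assms(2)]) auto
  next
    case False
    \<comment> \<open>The leaf \<open>a\<close> lies in the other subtree; as nodes are unordered,
      the two subtrees may trade places.\<close>
    have "tree_graphs (graft a t (Node (Upair r s))) =
        (pcomp Graph_operad (W \<union> V - {a}) a U (tree_graphs (Node (Upair r s))) (tree_graphs t) :: _ \<Rightarrow>\<^sub>0 'k)"
      using False Node by (intro tree_graphs_graft_Node[OF _ _ assms(2)]) auto
    moreover have "Upair r s = Upair s r" by simp
    ultimately show ?thesis by (simp only: Un_commute)
  qed
qed

lemma tree_graphs_map:
  assumes "is_tree_on V t" "inj_on \<sigma> V"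
  shows "tree_graphs (map_ctree \<sigma> t) = (transport Graph_operad V \<sigma> (tree_graphs t) :: _ \<Rightarrow>\<^sub>0 'k::field)"
  using assms
proof (induction rule: is_tree_on.induct)
  case (Node V s W t)
  let ?R = "\<lambda>g. (\<sigma> ` fst g, (`) \<sigma> ` snd g)"
  have rel: "join (?R g) (?R h) = (lin_ext (\<lambda>g. Poly_Mapping.single (?R g) 1) (join g h) :: _ \<Rightarrow>\<^sub>0 'k)"
    if "g \<in> spanning_trees V" "h \<in> spanning_trees W" for g h
  proof -
    have fst: "fst g = V" "fst h = W" using that by (auto simp: spanning_trees_def)
    \<comment> \<open>The pairs of endpoints after relabelling are the image of
      \<open>V \<times> W\<close> under this map, so the sum defining \<open>join\<close> can be
      reindexed.\<close>
    have inj: "inj_on (map_prod \<sigma> \<sigma>) (V \<times> W)"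
      using Node.prems by (intro map_prod_inj_on) (auto simp: inj_on_Un)
    show ?thesis
      unfolding join_def lin_ext_sum fst fst_conv map_prod_surj_on[OF refl refl, symmetric] sum.reindex[OF inj]
      by (intro sum.cong refl) (simp add: split_beta image_Un)
  qed
  have "tree_graphs (map_ctree \<sigma> (Node (Upair s t))) =
      bilinear_ext join (transport Graph_operad V \<sigma> (tree_graphs s)) (transport Graph_operad W \<sigma> (tree_graphs t :: _ \<Rightarrow>\<^sub>0 'k))"
    using Node by (simp add: tree_graphs_Node inj_on_Un)
  also have "\<dots> = bilinear_ext (\<lambda>g h. lin_ext (\<lambda>g. Poly_Mapping.single (?R g) 1) (join g h)) (tree_graphs s) (tree_graphs t)"
    unfolding Graph_operad_sel bilinear_ext_lin_ext
    by (rule bilinear_ext_cong[OF tree_graphs_mem[OF Node(1)] tree_graphs_mem[OF Node(2)]])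
      (simp add: bilinear_ext_def rel[symmetric])
  also have "\<dots> = transport Graph_operad (V \<union> W) \<sigma> (tree_graphs (Node (Upair s t)))"
    by (simp add: tree_graphs_Node lin_ext_bilinear_ext)
  finally show ?case .
qed simp

text \<open>Naturality comes from \<open>tree_graphs_map\<close> and compatibility with composition
  from \<open>tree_graphs_graft\<close>, both stated for single trees and extended linearly.\<close>

lemma operad_hom_tree_graphs:
  "operad_hom ComMag (Graph_operad :: ('v, 'k::field, _) operad) (\<lambda>V. lin_ext tree_graphs)"
  unfolding operad_hom_def
proof (intro conjI allI impI ballI, goal_cases)
  case 1 show ?case by (auto intro!: lin_ext_mem tree_graphs_simple)
next
  case 2 show ?case by (simp add: linear_on_lin_ext)
next
  case (3 V \<sigma> x)
  then have "lin_ext (\<lambda>t. tree_graphs (map_ctree \<sigma> t)) x =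
      lin_ext (\<lambda>t. transport Graph_operad V \<sigma> (tree_graphs t :: _ \<Rightarrow>\<^sub>0 'k)) x"
    by (intro lin_ext_cong'[of x "{t. is_tree_on V t}"] tree_graphs_map) auto
  then show ?case by (simp add: lin_ext_lin_ext)
next
  case 4 show ?case by simp
next
  case (5 V1 a V2 x y)
  then have V: "insert a V1 - {a} = V1" "V1 \<inter> V2 = {}" by (auto simp: composable_def)
  have "bilinear_ext (\<lambda>s t. tree_graphs (graft a t s)) x y =
      bilinear_ext (\<lambda>s t. pcomp Graph_operad V1 a V2 (tree_graphs s) (tree_graphs t :: _ \<Rightarrow>\<^sub>0 'k)) x y"
    using 5 tree_graphs_graft[of "insert a V1" _ V2 _ a, unfolded V]
    by (intro bilinear_ext_cong[of x "{t. is_tree_on (insert a V1) t}" y "{t. is_tree_on V2 t}"]) (auto simp: V)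
  then show ?case by (simp add: lin_ext_bilinear_ext bilinear_ext_lin_ext)
qed

section \<open>Injectivity of the morphism and its image\<close>

lemma inj_on_tree_graphs:
  assumes "finite V"
  shows "inj_on (lin_ext tree_graphs :: _ \<Rightarrow> _ \<Rightarrow>\<^sub>0 'k::field_char_0) (free_space {t. is_tree_on V t})"
proof (rule inj_onI)
  fix x y :: "_ \<Rightarrow>\<^sub>0 'k"
  assume x: "x \<in> free_space {t. is_tree_on V t}" and y: "y \<in> free_space {t. is_tree_on V t}"
    and eq: "lin_ext tree_graphs x = (lin_ext tree_graphs y :: _ \<Rightarrow>\<^sub>0 'k)"
  let ?c = "\<lambda>t. Poly_Mapping.lookup x t - Poly_Mapping.lookup y t"
  have "(\<Sum>t | is_tree_on V t. ?c t * Poly_Mapping.lookup (tree_graphs t) (V, E)) = 0" for E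
  proof -
    have "(\<Sum>t | is_tree_on V t. Poly_Mapping.lookup z t * Poly_Mapping.lookup (tree_graphs t) (V, E)) =
        Poly_Mapping.lookup (lin_ext tree_graphs z) (V, E)" if "z \<in> free_space {t. is_tree_on V t}" for z :: "_ \<Rightarrow>\<^sub>0 'k"
      using that finite_trees[OF assms]
      by (intro lookup_lin_ext_superset[symmetric]) (auto simp: free_space_def)
    from this[OF x] this[OF y] show ?thesis
      using eq by (simp add: left_diff_distrib sum_subtractf)
  qed
  then have "?c t = 0" if "is_tree_on V t" for t
    using tree_graphs_independent[OF assms, of ?c] that by blast
  then have "Poly_Mapping.lookup x t = Poly_Mapping.lookup y t" for t
    using x y by (cases "is_tree_on V t") (auto simp: free_space_iff)
  then show "x = y" by (rule poly_mapping_eqI)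
qed

text \<open>A node arises from its subtrees by two compositions with a segment, and every segment is
  a relabelling of the given one.\<close>

lemma tree_graphs_in_suboperad:
  fixes S :: "'v set \<Rightarrow> ('v sgraph \<Rightarrow>\<^sub>0 'k::field) set"
  assumes S: "suboperad Graph_operad S" and ab: "segment a b \<in> S {a, b}" "a \<noteq> b"
    and "is_tree_on V t"
  shows "tree_graphs t \<in> S V"
  using assms(4)
proof (induction rule: is_tree_on.induct)
  case (Leaf v)
  show ?case using S unfolding suboperad_def by simp
next
  case (Node V s W t)
  obtain p q where pq: "p \<in> V" "q \<in> W" "p \<noteq> q"
    using is_tree_on_nonempty[OF Node(1)] is_tree_on_nonempty[OF Node(2)] Node by blast
  \<comment> \<open>Relabels the generator so that its ends become vertices of the two
    subtrees.\<close>
  let ?\<sigma> = "(\<lambda>_. q)(a := p)"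
  have "inj_on ?\<sigma> {a, b}" using ab pq by (auto simp: inj_on_def)
  then have "transport Graph_operad {a, b} ?\<sigma> (segment a b) \<in> S (?\<sigma> ` {a, b})"
    by (intro suboperad_transport[OF S _ _ ab(1)]) simp
  moreover have img: "?\<sigma> ` {a, b} = {p, q}" using ab by auto
  moreover have "transport Graph_operad {a, b} ?\<sigma> (segment a b) = (segment p q :: _ \<Rightarrow>\<^sub>0 'k)"
    unfolding segment_def Graph_operad_sel lin_ext_single fst_conv snd_conv image_insert[of "image ?\<sigma>"] img by simp
  ultimately have seg: "segment p q \<in> S (insert p {q})" by (simp only:)
  have fin: "finite V" "finite W" using Node is_tree_on_nonempty by blast+
  have "pcomp Graph_operad {q} p V (segment p q) (tree_graphs s) \<in> S ({q} \<union> V)"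
    by (rule suboperad_pcomp[OF S _ seg Node.IH(1)]) (use pq Node fin in \<open>auto simp: composable_def\<close>)
  then have "pcomp Graph_operad V q W (pcomp Graph_operad {q} p V (segment p q) (tree_graphs s)) (tree_graphs t)
      \<in> S (V \<union> W)"
    by (intro suboperad_pcomp[OF S _ _ Node.IH(2)]) (use pq Node fin in \<open>auto simp: composable_def\<close>)
  then show ?case unfolding tree_graphs_Node_eq_pcomp[OF Node(1-3) pq(2,3)] .
qed

text \<open>The image of the morphism is itself a suboperad containing the generator, and by
  \<open>tree_graphs_in_suboperad\<close> it lies in every other one, so it is the smallest.\<close>

lemma spc_Seg:
  assumes "a \<noteq> b" "finite V"
  shows "spc (Seg a b :: ('v, 'k::field, _) operad) V = lin_ext tree_graphs ` free_space {t. is_tree_on V t}"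
proof -
  let ?S = "\<lambda>V. lin_ext tree_graphs ` free_space {t. is_tree_on V t} :: ('v sgraph \<Rightarrow>\<^sub>0 'k) set"
  have "suboperad Graph_operad ?S"
    by (rule suboperad_image[OF operad_ComMag operad_Graph_operad operad_hom_tree_graphs]) simp
  moreover have "segment a b \<in> ?S {a, b}"
  proof (rule image_eqI)
    \<comment> \<open>The generating segment is the image of the tree with two leaves, the generator
      of \<open>ComMag\<close>.\<close>
    let ?t = "Node (Upair (Leaf a) (Leaf b))"
    show "segment a b = (lin_ext tree_graphs (Poly_Mapping.single ?t 1) :: _ \<Rightarrow>\<^sub>0 'k)"
      by (simp add: tree_graphs_Node bilinear_ext_def join_def segment_def insert_commute)
    show "Poly_Mapping.single ?t 1 \<in> free_space {t. is_tree_on {a, b} t}"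
      using is_tree_on.Node[OF is_tree_on.Leaf[of a] is_tree_on.Leaf[of b]] assms(1)
      by (simp add: insert_commute)
  qed
  moreover have "lin_ext tree_graphs x \<in> S V"
    if S: "suboperad Graph_operad S" "segment a b \<in> S {a, b}" and x: "x \<in> free_space {t. is_tree_on V t}"
    for S :: "'v set \<Rightarrow> ('v sgraph \<Rightarrow>\<^sub>0 'k) set" and x
  proof -
    interpret vector_space "pm_scale :: 'k \<Rightarrow> ('v sgraph \<Rightarrow>\<^sub>0 'k) \<Rightarrow> _" by (rule vector_space_pm_scale)
    have "subspace (S V)" using S(1) assms(2) by (simp add: suboperad_def)
    then show ?thesis
      unfolding lin_ext_def using x tree_graphs_in_suboperad[OF S assms(1)]
      by (intro subspace_sum subspace_scale) (auto simp: free_space_def)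
  qed
  ultimately have "\<Inter> {S V |S. suboperad Graph_operad S \<and> segment a b \<in> S {a, b}} = ?S V" by blast
  then show ?thesis by (simp add: Seg_def generated_suboperad_def)
qed

theorem proposition2p9:
  fixes a b :: 'v
  assumes "infinite (UNIV :: 'v set)" and "a \<noteq> b"
  shows "operad_isomorphic (Seg a b :: ('v, 'k::field_char_0, 'v sgraph \<Rightarrow>\<^sub>0 'k) operad) ComMag"
proof -
  \<comment> \<open>\<open>Seg a b\<close> has the operations of \<open>Graph_operad\<close> and
    differs from it only in its spaces, so it has the form treated in
    \<open>operad_isomorphic_image\<close>.\<close>
  have "operad_isomorphic (Graph_operad\<lparr>spc := spc (Seg a b)\<rparr>) (ComMag :: ('v, 'k, _) operad)"
    by (rule operad_isomorphic_image[OF operad_ComMag operad_Graph_operad operad_hom_tree_graphs])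
      (simp_all add: spc_Seg[OF assms(2)] inj_on_tree_graphs)
  then show ?thesis by (simp add: Seg_def generated_suboperad_def)
qed

end
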